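(* Let $0<\delta\le 1$, let $g$ be a nonconstant real trigonometric polynomial, $g(x)=\sum_{|k|\le N}C_k e^{2\pi i kx}$ with $C_{-k}=\overline{C_k}$ and $C_0=0$, and let $G_\delta(x)=\sum_{n=1}^{\infty}g(n^2x)\,n^{-1-\delta}$. Then the box dimension of the graph of $G_\delta$ exists and $$\dim_{\mathrm B}(\mathrm{graph}\,G_\delta)=\frac74-\frac{\delta}{2}.$$ In particular, this equality holds regardless of which of the square-class sums $S_d=\sum_{m\ge1}C_{m^2d}\,(m^2d)^{\delta/2}$ ($d\ge1$ square-free) vanish, so that no vanishing among the $S_d$ can lower the box dimension of the graph of $G_\delta$.
   Context: The graph of $G_\delta$ is $\{(x,G_\delta(x)):x\in[0,1]\}\subset\mathbb R^2$. The box dimension $\dim_{\mathrm B}(E)$ of a bounded set $E$ is $\lim_{N\to\infty}\frac{\log A_N(E)}{\log N}$, where $A_N(E)$ is the minimum number of boxes of side $1/N$ needed to cover $E$ (the lower and upper box dimensions being the corresponding $\liminf$ and $\limsup$). In the sums $S_d$, $C_k=0$ for $|k|>N$. *)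

theory Defs
  imports "HOL-Analysis.Analysis" "HOL-Computational_Algebra.Squarefree"
begin

text \<open>
  The boxes are closed axis-parallel cubes in arbitrary position; for a bounded set and
  \<open>n \<ge> 1\<close> a finite cover exists, so the minimum is attained.
\<close>

definition is_box :: "real \<Rightarrow> 'a::euclidean_space set \<Rightarrow> bool" where
  "is_box s B \<longleftrightarrow> (\<exists>a. B = cbox a (a + s *\<^sub>R One))"

definition box_count :: "nat \<Rightarrow> 'a::euclidean_space set \<Rightarrow> nat" where
  "box_count n E =
     (LEAST m. \<exists>\<B>. finite \<B> \<and> card \<B> = m \<and> (\<forall>B\<in>\<B>. is_box (1 / real n) B) \<and> E \<subseteq> \<Union>\<B>)"

definition has_box_dim :: "'a::euclidean_space set \<Rightarrow> bool" where
  "has_box_dim E \<longleftrightarrow> convergent (\<lambda>n. ln (real (box_count n E)) / ln (real n))"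

text \<open>Meaningful only under \<^const>\<open>has_box_dim\<close>.\<close>

definition box_dim :: "'a::euclidean_space set \<Rightarrow> real" where
  "box_dim E = lim (\<lambda>n. ln (real (box_count n E)) / ln (real n))"

text \<open>
  The coefficient family is indexed by all integers, hence the requirement that it vanish
  outside \<open>[-N, N]\<close>; the square-class sums below refer to such indices.
\<close>

definition real_trig_poly :: "nat \<Rightarrow> (int \<Rightarrow> complex) \<Rightarrow> (real \<Rightarrow> real) \<Rightarrow> bool" where
  "real_trig_poly N C g \<longleftrightarrow>
     (\<forall>x. complex_of_real (g x) =
        (\<Sum>k = - int N..int N. C k * exp (2 * of_real pi * \<i> * of_int k * of_real x))) \<and>
     (\<forall>k. C (- k) = cnj (C k)) \<and>
     (\<forall>k. \<bar>k\<bar> > int N \<longrightarrow> C k = 0)"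

definition G :: "real \<Rightarrow> (real \<Rightarrow> real) \<Rightarrow> real \<Rightarrow> real" where
  "G \<delta> g x = (\<Sum>n. g ((real (Suc n))\<^sup>2 * x) * real (Suc n) powr (- 1 - \<delta>))"

definition graph_G :: "real \<Rightarrow> (real \<Rightarrow> real) \<Rightarrow> (real \<times> real) set" where
  "graph_G \<delta> g = {(x, G \<delta> g x) | x. x \<in> {0..1}}"

definition square_class_sum :: "real \<Rightarrow> (int \<Rightarrow> complex) \<Rightarrow> nat \<Rightarrow> complex" where
  "square_class_sum \<delta> C d =
     (\<Sum>m. C (int ((Suc m)\<^sup>2 * d)) * of_real (real ((Suc m)\<^sup>2 * d) powr (\<delta> / 2)))"

end

theory Submission
  imports Defs "HOL-Real_Asymp.Real_Asymp"
begin

text \<open>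
  Split the series at \<open>n\<^sup>2 \<approx> X\<close>, where \<open>1 / X\<close> is the side of the boxes. The number of solutions of
  \<open>p\<^sup>2 + r\<^sup>2 = q\<^sup>2 + s\<^sup>2\<close> up to \<open>M\<close> is \<open>O(M\<^sup>2 ln M)\<close>, so the \<open>L\<^sup>4\<close> norm of a dyadic block of the series
  is, up to logarithms, as small as its \<open>L\<^sup>2\<close> norm. The smoothness exponent \<open>1/4 + \<delta>/2\<close> that this yields
  exceeds \<open>1/4\<close>, so a Sobolev inequality in \<open>L\<^sup>4\<close> bounds the mean oscillation over intervals of length
  \<open>1 / X\<close> by \<open>X\<close> to the power \<open>- 1/4 - \<delta>/2\<close>, which is the upper bound \<open>7/4 - \<delta>/2\<close>.

  For the lower bound, pair the increment \<open>f(x) = G(x + 1/X) - G(x)\<close> with \<open>P(x) = \<Sum> e(k\<^sub>0 n\<^sup>2 x)\<close>, where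
  \<open>k\<^sub>0\<close> is the least positive frequency of \<open>g\<close> and \<open>n \<approx> \<surd>X\<close> runs through \<open>n \<equiv> 1\<close> modulo \<open>K!\<close>. The
  frequencies \<open>k\<^sub>0 n\<^sup>2\<close> arise from a single term of the double series, so nothing can cancel, whatever
  the sums \<open>S\<^sub>d\<close> are. The fourth moments of \<open>f\<close> and \<open>P\<close> turn the lower bound for \<open>\<integral> f P\<close> into a lower
  bound for \<open>\<integral> \<bar>f\<bar>\<close>, and \<open>X\<^sup>2 \<integral> \<bar>f\<bar>\<close> is at most six times the number of boxes.
\<close>

section \<open>Pairs of squares with equal sums\<close>

text \<open>The obstacle is small \<open>\<delta>\<close>. In mean square a dyadic block also has
  smoothness \<open>1/4 + \<delta>/2\<close>, but there a bound on the oscillation would need more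
  than \<open>1/2\<close>, which fails for \<open>\<delta> \<le> 1/2\<close>; with fourth powers
  more than \<open>1/4\<close> is enough, at the price of the arithmetic count. Powers of
  \<open>ln X\<close> vanish in the ratio of logarithms, so they are spent freely. In particular the
  tail of the series is only estimated uniformly, by a multiple of \<open>T\<close> to the power
  \<open>- \<delta>\<close>; pushing it down to order \<open>1 / X\<close> takes a huge cutoff
  \<open>T\<close>, of order at least \<open>X\<close> to the power \<open>1 / \<delta>\<close>, but
  still only \<open>O(ln X)\<close> dyadic blocks. In the other direction, counting boxes controls
  only the mean absolute increment. A large mean square could come from a small set of
  \<open>x\<close>; the fourth moments exclude this, because the part of
  \<open>\<integral> f P\<close> where \<open>P\<close> is unusually large is at most half of the
  lower bound once the threshold is a suitable power of \<open>ln X\<close> above the typical size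
  of \<open>P\<close>.\<close>

lemma sum_inverse_le_ln:
  "(\<Sum>u = 1..n. 1 / real u) \<le> 1 + ln (real n)" if "n \<ge> 1"
  using that
proof (induction n rule: dec_induct)
  case (step n)
  have "ln (real n / real (Suc n)) \<le> real n / real (Suc n) - 1"
    using step.hyps by (intro ln_le_minus_one) auto
  also have "\<dots> = - (1 / real (Suc n))"
    by (simp add: field_simps)
  finally have "1 / real (Suc n) \<le> ln (real (Suc n)) - ln (real n)"
    using step.hyps by (simp add: ln_div)
  then show ?case
    using step.IH by simp
qed simp

text \<open>For a given larger entry \<open>u\<close> the smaller one has \<open>u\<close> values,
  so each half of the square contributes a harmonic sum; the diagonal is counted twice.\<close>

lemma sum_inverse_max_square_le:
  assumes "X \<ge> 1"
  shows "(\<Sum>(u, v)\<in>{1..X} \<times> {1..X}. 1 / real (max u v)^2) \<le> 2 * (1 + ln (real X))"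
proof -
  have "(\<Sum>(u, v)\<in>{1..X} \<times> {1..X}. 1 / real (max u v)^2)
      = (\<Sum>u=1..X. \<Sum>v=1..X. 1 / real (max u v)^2)"
    by (simp add: sum.cartesian_product)
  also have "\<dots> \<le> (\<Sum>u=1..X. \<Sum>v=1..X. (if v \<le> u then 1 / real u^2 else 0) + (if u \<le> v then 1 / real v^2 else 0))"
    by (intro sum_mono) (auto simp: max_def)
  also have "\<dots> = (\<Sum>u=1..X. \<Sum>v=1..X. if v \<le> u then 1 / real u^2 else 0)
                + (\<Sum>v=1..X. \<Sum>u=1..X. if u \<le> v then 1 / real v^2 else 0)"
    by (simp add: sum.distrib) (rule sum.swap)
  also have "\<dots> = 2 * (\<Sum>u=1..X. \<Sum>v=1..X. if v \<le> u then 1 / real u^2 else 0)"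
    by simp
  also have "(\<Sum>u=1..X. \<Sum>v=1..X. if v \<le> u then 1 / real u^2 else 0) = (\<Sum>u=1..X. 1 / real u)"
  proof (intro sum.cong refl)
    fix u assume u: "u \<in> {1..X}"
    have "(\<Sum>v=1..X. if v \<le> u then 1 / real u^2 else 0) = (\<Sum>v\<in>{1..X} \<inter> {v. v \<le> u}. 1 / real u^2)"
      by (subst sum.inter_restrict) auto
    also have "{1..X} \<inter> {v. v \<le> u} = {1..u}"
      using u by auto
    finally show "(\<Sum>v=1..X. if v \<le> u then 1 / real u^2 else 0) = 1 / real u"
      by (simp add: power2_eq_square)
  qed
  finally show ?thesis
    using sum_inverse_le_ln[OF assms] by simp
qed

text \<open>With \<open>g = gcd a c\<close> every solution has the form \<open>a = g * u\<close>,
  \<open>c = g * v\<close>, \<open>b = v * w\<close>, \<open>d = u * w\<close>. For given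
  \<open>u, v\<close> both \<open>g\<close> and \<open>w\<close> are at most
  \<open>X div max u v\<close>, so the count is a sum of squares of these bounds.\<close>

lemma card_equal_products_le:
  assumes "X \<ge> 1"
  shows "real (card {(a, b, c, d). a \<in> {1..X} \<and> b \<in> {1..X} \<and> c \<in> {1..X} \<and> d \<in> {1..X} \<and> a * b = c * d})
    \<le> 2 * real X^2 * (1 + ln (real X))"
    (is "real (card ?S) \<le> _")
proof -
  define P where "P = {1..X} \<times> {1..X}"
  define I where "I = (\<lambda>(u, v). {1..X div max u v} \<times> {1..X div max u v})"
  define \<phi> where "\<phi> = (\<lambda>((u, v), (g, w)). (g * u, v * w, g * v, u * w :: nat))"
  have "?S \<subseteq> \<phi> ` Sigma P I"
  proof
    fix q assume "q \<in> ?S"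
    then obtain a b c d where q: "q = (a, b, c, d)"
      and r: "a \<in> {1..X}" "b \<in> {1..X}" "c \<in> {1..X}" "d \<in> {1..X}" and eq: "a * b = c * d"
      by auto
    define g where "g = gcd a c"
    define u v where "u = a div g" and "v = c div g"
    have g: "g > 0" using r by (simp add: g_def)
    have a: "a = g * u" and c: "c = g * v"
      by (simp_all add: g_def u_def v_def)
    have cop: "coprime u v"
      unfolding u_def v_def g_def using r by (intro div_gcd_coprime) auto
    have "u * b = v * d"
      using eq g by (simp add: a c)
    then have "u dvd d"
      using cop by (metis coprime_dvd_mult_right_iff dvd_triv_left)
    then obtain w where d: "d = u * w" ..
    have u0: "u > 0" and v0: "v > 0" using r a c by (auto intro: gr0I)
    have b: "b = v * w"
      using \<open>u * b = v * d\<close> u0 by (simp add: d ac_simps)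
    have w0: "w > 0" using r d by (auto intro: gr0I)
    have le: "g \<le> X div max u v" "w \<le> X div max u v"
      using r a b c d u0 v0 by (auto simp: max_def less_eq_div_iff_mult_less_eq ac_simps)
    have "u \<le> X" "v \<le> X"
      using r a c g by (auto intro: order_trans[rotated])
    then have "((u, v), (g, w)) \<in> Sigma P I"
      using u0 v0 w0 g le by (auto simp: P_def I_def)
    moreover have "q = \<phi> ((u, v), (g, w))"
      by (simp add: q \<phi>_def a b c d)
    ultimately show "q \<in> \<phi> ` Sigma P I" by blast
  qed
  moreover have "finite (Sigma P I)"
    by (intro finite_SigmaI) (auto simp: P_def I_def)
  ultimately have "card ?S \<le> card (Sigma P I)"
    by (meson card_image_le card_mono finite_imageI order_trans)
  also have "card (Sigma P I) = (\<Sum>p\<in>P. card (I p))"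
    by (intro card_SigmaI) (auto simp: P_def I_def)
  finally have "real (card ?S) \<le> real (\<Sum>p\<in>P. card (I p))"
    by (rule of_nat_mono)
  also have "\<dots> = (\<Sum>p\<in>P. real (card (I p)))"
    by simp
  also have "\<dots> \<le> (\<Sum>(u, v)\<in>P. real X^2 * (1 / real (max u v)^2))"
  proof (intro sum_mono, clarify)
    fix u v assume "(u, v) \<in> P"
    have "real (card (I (u, v))) = real (X div max u v)^2"
      by (simp add: I_def power2_eq_square)
    also have "\<dots> \<le> (real X / real (max u v))^2"
      by (intro power_mono of_nat_div_le_of_nat) auto
    finally show "real (card (I (u, v))) \<le> real X^2 * (1 / real (max u v)^2)"
      by (simp add: power_divide)
  qed
  also have "\<dots> = real X^2 * (\<Sum>(u, v)\<in>P. 1 / real (max u v)^2)"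
    by (simp add: sum_distrib_left case_prod_unfold)
  also have "\<dots> \<le> real X^2 * (2 * (1 + ln (real X)))"
    unfolding P_def by (intro mult_left_mono sum_inverse_max_square_le assms) auto
  also have "\<dots> = 2 * real X^2 * (1 + ln (real X))" by simp
  finally show ?thesis .
qed

text \<open>The entries alternate between the two sides because \<open>norm F^4\<close> expands as
  \<open>F * cnj F * F * cnj F\<close>, with indices \<open>p, q, r, s\<close> in this
  order.\<close>

definition square_quads :: "nat \<Rightarrow> (nat \<times> nat \<times> nat \<times> nat) set" where
  "square_quads M = {(p, q, r, s). p \<in> {1..M} \<and> q \<in> {1..M} \<and> r \<in> {1..M} \<and> s \<in> {1..M} \<and>
     p^2 + r^2 = q^2 + s^2}"

lemma finite_square_quads [simp]: "finite (square_quads M)"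
  by (rule finite_subset[of _ "{1..M} \<times> {1..M} \<times> {1..M} \<times> {1..M}"]) (auto simp: square_quads_def)

text \<open>Off the diagonal, the difference of two squares factors, which reduces the count to
  quadruples with equal products.\<close>

lemma card_square_quads_le:
  assumes "M \<ge> 1"
  shows "real (card (square_quads M)) \<le> 17 * real M^2 * (1 + ln (2 * real M))"
proof -
  define S where "S = {(a, b, c, d). a \<in> {1..2*M} \<and> b \<in> {1..2*M} \<and> c \<in> {1..2*M} \<and> d \<in> {1..2*M} \<and> a * b = c * d}"
  define D where "D = {(p, q, r, s) \<in> square_quads M. p = q}"
  define U where "U = {(p, q, r, s) \<in> square_quads M. q < p}"
  define V where "V = {(p, q, r, s) \<in> square_quads M. p < q}"
  \<comment> \<open>The equation reads \<open>p^2 - q^2 = s^2 - r^2\<close>, and \<open>f\<close>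
    lists the factors of both sides. Sums of two entries reach \<open>2 * M\<close>, hence the range
    in \<open>S\<close>.\<close>
  define f where "f = ((\<lambda>(p, q, r, s). (p - q, p + q, s - r, s + r)) :: nat \<times> nat \<times> nat \<times> nat \<Rightarrow> _)"
  define h where "h = ((\<lambda>(p, q, r, s). (q, p, s, r)) :: nat \<times> nat \<times> nat \<times> nat \<Rightarrow> _)"
  have finS: "finite S"
    by (rule finite_subset[of _ "{1..2*M} \<times> {1..2*M} \<times> {1..2*M} \<times> {1..2*M}"]) (auto simp: S_def)
  have less: "r < s" if "q < p" "p^2 + r^2 = q^2 + s^2" for p q r s :: nat
    using that power_strict_mono[of q p 2] by (intro power_less_imp_less_base[of r 2 s]) auto
  have "inj_on f U"
  proof (rule inj_onI)
    fix x y assume *: "x \<in> U" "y \<in> U" "f x = f y"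
    obtain p q r s p' q' r' s' where xy: "x = (p, q, r, s)" "y = (p', q', r', s')"
      by (metis prod_cases4)
    have "q < p" "q' < p'" "r < s" "r' < s'"
      using * less by (auto simp: xy U_def square_quads_def)
    with *(3) show "x = y"
      by (auto simp: f_def xy)
  qed
  moreover have "f ` U \<subseteq> S"
  proof (rule image_subsetI)
    fix x assume "x \<in> U"
    obtain p q r s where x: "x = (p, q, r, s)"
      by (metis prod_cases4)
    from \<open>x \<in> U\<close> have r: "p \<in> {1..M}" "q \<in> {1..M}" "r \<in> {1..M}" "s \<in> {1..M}" "q < p"
      and eq: "p^2 + r^2 = q^2 + s^2"
      by (auto simp: x U_def square_quads_def)
    have rs: "r < s" using less r eq by blast
    have "(x - y) * (x + y) = x^2 - y^2" if "y < x" for x y :: nat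
      using that le_Suc_ex[of y x] by (auto simp: power2_eq_square algebra_simps)
    from this[of q p] this[of r s] r rs
    have "(p - q) * (p + q) = p^2 - q^2" "(s - r) * (s + r) = s^2 - r^2" by simp_all
    then have "(p - q) * (p + q) = (s - r) * (s + r)"
      using eq by linarith
    then show "f x \<in> S"
      using r rs by (auto simp: x f_def S_def)
  qed
  ultimately have U: "card U \<le> card S"
    using finS card_inj_on_le by blast
  \<comment> \<open>Exchanging the two sides of the equation carries the case \<open>p < q\<close>
    to the case \<open>q < p\<close>.\<close>
  have "inj_on h V" "h ` V \<subseteq> U"
    by (auto simp: inj_on_def h_def U_def V_def square_quads_def)
  then have V: "card V \<le> card U"
    by (rule card_inj_on_le) (auto simp: U_def intro: finite_subset[OF _ finite_square_quads[of M]])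
  \<comment> \<open>On the diagonal \<open>p = q\<close> forces \<open>r = s\<close>.\<close>
  have "D \<subseteq> (\<lambda>(p, r). (p, p, r, r)) ` ({1..M} \<times> {1..M})"
    by (auto simp: D_def square_quads_def image_iff)
  then have "card D \<le> card ({1..M} \<times> {1..M})"
    by (meson card_image_le card_mono finite_SigmaI finite_atLeastAtMost finite_imageI order_trans)
  then have D: "card D \<le> M^2"
    by (simp add: power2_eq_square)
  have "square_quads M = D \<union> (U \<union> V)"
    by (auto simp: D_def U_def V_def)
  then have "card (square_quads M) \<le> card D + (card U + card V)"
    by (metis add_left_mono card_Un_le order_trans)
  also have "\<dots> \<le> M^2 + 2 * card S"
    using U V D by linarith
  finally have "real (card (square_quads M)) \<le> real (M^2 + 2 * card S)"
    by (rule of_nat_mono)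
  also have "\<dots> = real M^2 + 2 * real (card S)"
    by simp
  also have "real (card S) \<le> 2 * real (2*M)^2 * (1 + ln (real (2*M)))"
    unfolding S_def using assms by (intro card_equal_products_le) simp
  finally have *: "real (card (square_quads M)) \<le> real M^2 + 16 * real M^2 * (1 + ln (2 * real M))"
    by (simp add: power_mult_distrib)
  have "real M^2 * 1 \<le> real M^2 * (1 + ln (2 * real M))"
    using assms by (intro mult_left_mono) auto
  with * show ?thesis by linarith
qed

section \<open>Trigonometric sums over squares\<close>

definition echar :: "real \<Rightarrow> complex" where
  "echar x = cis (2 * pi * x)"

lemma norm_echar [simp]: "norm (echar x) = 1"
  by (simp add: echar_def)

lemma echar_0 [simp]: "echar 0 = 1"
  by (simp add: echar_def)

lemma echar_add: "echar (x + y) = echar x * echar y"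
  by (simp add: echar_def cis_mult distrib_left)

lemma cnj_echar: "cnj (echar x) = echar (- x)"
  by (simp add: echar_def cis_cnj)

lemma echar_int [simp]: "echar (of_int m) = 1"
  unfolding echar_def by (rule cis_multiple_2pi) auto

lemma echar_has_vector_derivative:
  "((\<lambda>x. echar (a * x)) has_vector_derivative (2 * pi * a) *\<^sub>R (\<i> * echar (a * x))) (at x within X)"
proof -
  have "((\<lambda>z. exp (\<i> * (2 * of_real pi * (of_real a * z)))) has_field_derivative
      (2 * pi * a) *\<^sub>R (\<i> * exp (\<i> * (2 * of_real pi * (of_real a * of_real x))))) (at (of_real x))"
    by (auto intro!: derivative_eq_intros simp: scaleR_conv_of_real)
  then show ?thesis
    unfolding echar_def cis_conv_exp
    by (drule_tac has_vector_derivative_real_field) simp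
qed

lemma continuous_on_echar [continuous_intros]:
  "continuous_on X f \<Longrightarrow> continuous_on X (\<lambda>x. echar (f x))"
  unfolding echar_def by (intro continuous_intros)

lemma norm_echar_minus_1_le: "norm (echar x - 1) \<le> 2 * pi * \<bar>x\<bar>"
  unfolding echar_def cis_conv_exp dist_exp_i_1
  using abs_sin_x_le_abs_x[of "pi * x"] by (simp add: abs_mult)

lemma has_integral_echar:
  "((\<lambda>x. echar (of_int m * x)) has_integral (if m = 0 then 1 else 0)) {0..1}"
proof (cases "m = 0")
  case True
  then show ?thesis
    using has_integral_const_real[of "1 :: complex" 0 1] by simp
next
  case False
  define F where "F x = (1 / (2 * pi * of_int m)) *\<^sub>R (- \<i> * echar (of_int m * x))" for x :: real
  have "(F has_vector_derivative echar (of_int m * x)) (at x within {0..1})" for x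
  proof -
    have "(F has_vector_derivative (1 / (2 * pi * of_int m)) *\<^sub>R (- \<i> * ((2 * pi * of_int m) *\<^sub>R (\<i> * echar (of_int m * x))))) (at x within {0..1})"
      unfolding F_def
      by (intro bounded_linear.has_vector_derivative[OF bounded_linear_scaleR_right] has_vector_derivative_mult_right echar_has_vector_derivative)
    then show ?thesis
      using False by simp
  qed
  then have "((\<lambda>x. echar (of_int m * x)) has_integral F 1 - F 0) {0..1}"
    by (intro fundamental_theorem_of_calculus) auto
  then show ?thesis
    using False by (simp add: F_def)
qed

text \<open>The coefficients may depend on both indices, so that derivatives and increments of such
  sums are sums of the same kind and one moment bound serves all of them.\<close>

definition trig_sum :: "(int \<Rightarrow> nat \<Rightarrow> complex) \<Rightarrow> int set \<Rightarrow> nat set \<Rightarrow> real \<Rightarrow> complex" where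
  "trig_sum c S A x = (\<Sum>k\<in>S. \<Sum>n\<in>A. c k n * echar (of_int k * (real n)^2 * x))"

lemma continuous_on_trig_sum [continuous_intros]:
  "continuous_on X f \<Longrightarrow> continuous_on X (\<lambda>x. trig_sum c S A (f x))"
  unfolding trig_sum_def by (intro continuous_intros)

lemma trig_sum_has_vector_derivative:
  "(trig_sum c S A has_vector_derivative
     trig_sum (\<lambda>k n. 2 * of_real pi * \<i> * of_int k * (of_nat n)^2 * c k n) S A x) (at x within X)"
proof -
  have "(trig_sum c S A has_vector_derivative
     (\<Sum>k\<in>S. \<Sum>n\<in>A. c k n * ((2 * pi * (of_int k * (real n)^2)) *\<^sub>R (\<i> * echar (of_int k * (real n)^2 * x))))) (at x within X)"
    unfolding trig_sum_def[abs_def]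
    by (intro has_vector_derivative_sum has_vector_derivative_mult_right echar_has_vector_derivative)
  also have "(\<Sum>k\<in>S. \<Sum>n\<in>A. c k n * ((2 * pi * (of_int k * (real n)^2)) *\<^sub>R (\<i> * echar (of_int k * (real n)^2 * x))))
     = trig_sum (\<lambda>k n. 2 * of_real pi * \<i> * of_int k * (of_nat n)^2 * c k n) S A x"
    unfolding trig_sum_def by (intro sum.cong refl) (simp add: scaleR_conv_of_real)
  finally show ?thesis .
qed

lemma trig_sum_diff:
  "trig_sum c S A (x + h) - trig_sum c S A x
     = trig_sum (\<lambda>k n. c k n * (echar (of_int k * (real n)^2 * h) - 1)) S A x"
  unfolding trig_sum_def sum_subtractf[symmetric]
  by (intro sum.cong refl) (simp add: echar_add[symmetric] algebra_simps)

text \<open>Cauchy-Schwarz twice, which is Hoelder's inequality with exponent 4.\<close>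

lemma norm_sum_power4_le:
  fixes z :: "'a \<Rightarrow> 'b::real_normed_vector"
  shows "norm (\<Sum>i\<in>I. z i)^4 \<le> real (card I)^3 * (\<Sum>i\<in>I. norm (z i)^4)"
proof -
  have sq: "(\<Sum>i\<in>I. f i)^2 \<le> (\<Sum>i\<in>I. (f i)^2) * card I" for f :: "'a \<Rightarrow> real"
    by (rule sum_squared_le_sum_of_squares)
  have "norm (\<Sum>i\<in>I. z i)^4 \<le> (\<Sum>i\<in>I. norm (z i))^4"
    by (intro power_mono norm_sum) auto
  also have "\<dots> = ((\<Sum>i\<in>I. norm (z i))^2)^2"
    by simp
  also have "\<dots> \<le> ((\<Sum>i\<in>I. (norm (z i))^2) * card I)^2"
    by (intro power_mono sq) auto
  also have "\<dots> = (\<Sum>i\<in>I. (norm (z i))^2)^2 * real (card I)^2"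
    by (simp add: power_mult_distrib)
  also have "\<dots> \<le> ((\<Sum>i\<in>I. ((norm (z i))^2)^2) * card I) * real (card I)^2"
    by (intro mult_right_mono sq) auto
  also have "\<dots> = real (card I)^3 * (\<Sum>i\<in>I. norm (z i)^4)"
    by (simp add: power2_eq_square power3_eq_cube power4_eq_xxxx mult.assoc)
  finally show ?thesis .
qed

text \<open>Expand the fourth power and integrate term by term. By orthogonality only quadruples of
  total frequency zero survive, and since \<open>k \<noteq> 0\<close> these lie in
  \<open>square_quads M\<close>; each contributes at most \<open>B^4\<close>.\<close>

lemma integral_norm_power4_square_sum_le:
  assumes k: "k \<noteq> (0 :: int)" and A: "A \<subseteq> {1..M}" and b: "\<And>n. n \<in> A \<Longrightarrow> norm (b n) \<le> B"
  shows "integral {0..1} (\<lambda>x. norm (\<Sum>n\<in>A. b n * echar (of_int k * (real n)^2 * x))^4)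
    \<le> B^4 * real (card (square_quads M))"
proof -
  have finA: "finite A" using A finite_subset by blast
  define T where "T = A \<times> A \<times> A \<times> A"
  have finT: "finite T" by (simp add: T_def finA)
  define w where "w = (\<lambda>(p, q, r, s). b p * cnj (b q) * (b r * cnj (b s)))"
  define m where "m = (\<lambda>(p :: nat, q :: nat, r :: nat, s :: nat). k * (int p^2 - int q^2 + int r^2 - int s^2))"
  define F where "F x = (\<Sum>n\<in>A. b n * echar (of_int k * (real n)^2 * x))" for x
  have eq: "complex_of_real (norm (F x)^4) = (\<Sum>t\<in>T. w t * echar (of_int (m t) * x))" for x
  proof -
    have "complex_of_real (norm (F x)^4) = (complex_of_real (norm (F x)^2))^2"
      by (simp flip: power_mult)
    also have "\<dots> = (F x * cnj (F x)) * (F x * cnj (F x))"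
      unfolding complex_norm_square by (simp only: power2_eq_square)
    also have "F x * cnj (F x) = (\<Sum>(p, q)\<in>A \<times> A. b p * cnj (b q) * echar (of_int k * ((real p)^2 - (real q)^2) * x))"
      unfolding F_def cnj_sum sum_product sum.cartesian_product
      by (intro sum.cong refl) (auto simp: cnj_echar algebra_simps echar_add[symmetric])
    also have "\<dots> * \<dots> = (\<Sum>((p, q), (r, s))\<in>(A \<times> A) \<times> (A \<times> A). w (p, q, r, s) * echar (of_int (m (p, q, r, s)) * x))"
      unfolding sum_product sum.cartesian_product
      by (intro sum.cong refl) (auto simp: w_def m_def algebra_simps echar_add[symmetric])
    also have "\<dots> = (\<Sum>t\<in>T. w t * echar (of_int (m t) * x))"
      unfolding T_def
      by (rule sum.reindex_bij_witness[of _ "\<lambda>(p, q, r, s). ((p, q), (r, s))" "\<lambda>((p, q), (r, s)). (p, q, r, s)"]) auto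
    finally show ?thesis .
  qed
  have "((\<lambda>x. \<Sum>t\<in>T. w t * echar (of_int (m t) * x)) has_integral (\<Sum>t\<in>T. w t * (if m t = 0 then 1 else 0))) {0..1}"
    by (intro has_integral_sum finT has_integral_mult_right has_integral_echar)
  then have I: "((\<lambda>x. complex_of_real (norm (F x)^4)) has_integral (\<Sum>t\<in>T. w t * (if m t = 0 then 1 else 0))) {0..1}"
    by (simp only: eq)
  have "continuous_on {0..1} (\<lambda>x. norm (F x)^4)"
    unfolding F_def by (intro continuous_intros)
  then have "((\<lambda>x. norm (F x)^4) has_integral integral {0..1} (\<lambda>x. norm (F x)^4)) {0..1}"
    by (intro integrable_integral integrable_continuous_real)
  then have "((\<lambda>x. complex_of_real (norm (F x)^4)) has_integral complex_of_real (integral {0..1} (\<lambda>x. norm (F x)^4))) {0..1}"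
    by (rule has_integral_of_real)
  with I have "complex_of_real (integral {0..1} (\<lambda>x. norm (F x)^4)) = (\<Sum>t\<in>T. w t * (if m t = 0 then 1 else 0))"
    by (rule has_integral_unique[symmetric])
  then have "\<bar>integral {0..1} (\<lambda>x. norm (F x)^4)\<bar> = norm (\<Sum>t\<in>T. w t * (if m t = 0 then 1 else 0))"
    by (metis norm_of_real)
  also have "\<dots> \<le> (\<Sum>t\<in>T. norm (w t * (if m t = 0 then 1 else 0)))"
    by (rule norm_sum)
  also have "\<dots> \<le> (\<Sum>t\<in>T. if t \<in> square_quads M then B^4 else 0)"
  proof (intro sum_mono)
    fix t assume "t \<in> T"
    obtain p q r s where t: "t = (p, q, r, s)" by (metis prod_cases4)
    have inA: "p \<in> A" "q \<in> A" "r \<in> A" "s \<in> A" using \<open>t \<in> T\<close> by (auto simp: T_def t)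
    have B: "B \<ge> 0" using b[OF inA(1)] norm_ge_zero order_trans by blast
    have "norm (w t) = norm (b p) * norm (b q) * (norm (b r) * norm (b s))"
      by (simp add: w_def t norm_mult)
    also have "\<dots> \<le> B * B * (B * B)"
      using inA b B by (intro mult_mono) auto
    finally have w: "norm (w t) \<le> B^4" by (simp add: power4_eq_xxxx ac_simps)
    have "t \<in> square_quads M" if "m t = 0"
    proof -
      have "int (p^2 + r^2) = int (q^2 + s^2)"
        using that k by (simp add: m_def t)
      then have "p^2 + r^2 = q^2 + s^2" using of_nat_eq_iff by blast
      then show ?thesis
        using inA A by (auto simp: square_quads_def t)
    qed
    then show "norm (w t * (if m t = 0 then 1 else 0)) \<le> (if t \<in> square_quads M then B^4 else 0)"
      using w by auto
  qed
  also have "\<dots> = B^4 * real (card (T \<inter> square_quads M))"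
    using finT by (simp add: sum.If_cases)
  also have "\<dots> \<le> B^4 * real (card (square_quads M))"
    by (intro mult_left_mono) (auto intro!: card_mono)
  finally show ?thesis
    by (simp add: F_def)
qed

text \<open>Hoelder over \<open>k\<close> costs \<open>card S\<close> cubed but treats each
  \<open>k\<close> separately, so that no equation mixing several \<open>k\<close> has to be
  counted.\<close>

lemma integral_norm_power4_trig_sum_le:
  assumes S: "finite S" "0 \<notin> S" and A: "A \<subseteq> {1..M}"
    and c: "\<And>k n. k \<in> S \<Longrightarrow> n \<in> A \<Longrightarrow> norm (c k n) \<le> B"
  shows "integral {0..1} (\<lambda>x. norm (trig_sum c S A x)^4)
    \<le> real (card S)^4 * B^4 * real (card (square_quads M))"
proof -
  define F where "F k x = (\<Sum>n\<in>A. c k n * echar (of_int k * (real n)^2 * x))" for k x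
  have cont: "continuous_on {0..1} (\<lambda>x. norm (F k x)^4)" for k
    unfolding F_def by (intro continuous_intros)
  have "integral {0..1} (\<lambda>x. norm (trig_sum c S A x)^4)
      \<le> integral {0..1} (\<lambda>x. real (card S)^3 * (\<Sum>k\<in>S. norm (F k x)^4))"
  proof (rule integral_le)
    show "norm (trig_sum c S A x)^4 \<le> real (card S)^3 * (\<Sum>k\<in>S. norm (F k x)^4)" for x
      unfolding trig_sum_def F_def by (rule norm_sum_power4_le)
  qed (intro integrable_continuous_real continuous_intros cont)+
  also have "\<dots> = real (card S)^3 * (\<Sum>k\<in>S. integral {0..1} (\<lambda>x. norm (F k x)^4))"
    using S by (simp add: integral_sum integrable_continuous_real cont)
  also have "\<dots> \<le> real (card S)^3 * (\<Sum>k\<in>S. B^4 * real (card (square_quads M)))"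
    unfolding F_def using S A c
    by (intro mult_left_mono sum_mono integral_norm_power4_square_sum_le) auto
  also have "\<dots> = real (card S)^4 * B^4 * real (card (square_quads M))"
    by (simp add: power4_eq_xxxx power3_eq_cube)
  finally show ?thesis .
qed

section \<open>Pointwise bounds on an interval from integrals of a function and its
  derivative\<close>

lemma norm_diff_le_integral:
  fixes u u' :: "real \<Rightarrow> complex"
  assumes u: "\<And>x. x \<in> {a..b} \<Longrightarrow> (u has_vector_derivative u' x) (at x within {a..b})"
    and u': "continuous_on {a..b} u'" and yz: "y \<in> {a..b}" "z \<in> {a..b}"
  shows "norm (u y - u z) \<le> integral {a..b} (\<lambda>x. norm (u' x))"
proof -
  have *: "norm (u y - u z) \<le> integral {a..b} (\<lambda>x. norm (u' x))" if "z \<le> y" "z \<in> {a..b}" "y \<in> {a..b}" for y z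
  proof -
    have sub: "{z..y} \<subseteq> {a..b}" using that by auto
    have I: "(u' has_integral u y - u z) {z..y}"
      using that sub
      by (intro fundamental_theorem_of_calculus) (auto intro: has_vector_derivative_within_subset[OF u])
    have c: "continuous_on {z..y} u'" using u' sub continuous_on_subset by blast
    have "norm (u y - u z) = norm (integral {z..y} u')"
      using I by (simp add: integral_unique)
    also have "\<dots> \<le> integral {z..y} (\<lambda>x. norm (u' x))"
      using c by (intro integral_norm_bound_integral integrable_continuous_real continuous_intros) auto
    also have "\<dots> \<le> integral {a..b} (\<lambda>x. norm (u' x))"
      using c u' sub by (intro integral_subset_le integrable_continuous_real continuous_intros) auto
    finally show ?thesis .
  qed
  show ?thesis
    using *[of z y] *[of y z] yz by (cases "z \<le> y") (auto simp: norm_minus_commute)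
qed

text \<open>Young's inequality with exponents \<open>4/3\<close> and \<open>4\<close>. For
  \<open>w = 1\<close> the difference of the two sides is divisible by \<open>(s - t)^2\<close>;
  replacing \<open>t\<close> by \<open>t / w\<close> and multiplying by \<open>w\<close> gives the
  weighted form.\<close>

lemma cube_times_le: "4 * s^3 * t \<le> 3 * w * s^4 + t^4 / w^3" if "w > 0" "s \<ge> 0" "t \<ge> 0" for s t w :: real
proof -
  have *: "4 * s^3 * t \<le> 3 * s^4 + t^4" if "s \<ge> 0" "t \<ge> 0" for s t :: real
  proof -
    have "0 \<le> (s - t)^2 * (3 * s^2 + 2 * s * t + t^2)" using that by simp
    also have "\<dots> = 3 * s^4 + t^4 - 4 * s^3 * t" by algebra
    finally show ?thesis by simp
  qed
  have "w * (4 * s^3 * (t / w)) \<le> w * (3 * s^4 + (t / w)^4)"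
    using that by (intro mult_left_mono *) auto
  moreover have "w * (4 * s^3 * (t / w)) = 4 * s^3 * t"
    using that by simp
  moreover have "w * (3 * s^4 + (t / w)^4) = 3 * w * s^4 + t^4 / w^3"
    using that by (simp add: field_simps power4_eq_xxxx power3_eq_cube)
  ultimately show ?thesis by simp
qed

text \<open>The Sobolev inequality. The value of \<open>u^4\<close> at \<open>y\<close> differs from
  that at any \<open>z\<close> by at most the integral of \<open>4 * norm u^3 * norm u'\<close>;
  averaging over \<open>z\<close> gives the term \<open>1 / (b - a)\<close>, and Young's inequality
  splits the integral. The weight \<open>w\<close> is meant to be the size of the frequencies of
  \<open>u\<close>.\<close>

lemma norm_power4_le_integral:
  fixes u u' :: "real \<Rightarrow> complex"
  assumes u: "\<And>x. x \<in> {a..b} \<Longrightarrow> (u has_vector_derivative u' x) (at x within {a..b})"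
    and u': "continuous_on {a..b} u'" and "a < b" and y: "y \<in> {a..b}" and w: "w > 0"
  shows "norm (u y)^4 \<le> (1 / (b - a) + 3 * w) * integral {a..b} (\<lambda>x. norm (u x)^4)
           + 1 / w^3 * integral {a..b} (\<lambda>x. norm (u' x)^4)"
proof -
  have cu: "continuous_on {a..b} u"
    unfolding continuous_on_eq_continuous_within
    by (intro ballI has_vector_derivative_continuous[OF u])
  define D where "D = integral {a..b} (\<lambda>x. norm (4 * u x^3 * u' x))"
  have *: "norm (u y)^4 \<le> norm (u z)^4 + D" if "z \<in> {a..b}" for z
  proof -
    have "((\<lambda>x. u x^4) has_vector_derivative 4 * u x^3 * u' x) (at x within {a..b})" if "x \<in> {a..b}" for x
    proof -
      have "((\<lambda>x. (u x * u x) * (u x * u x)) has_vector_derivative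
        (u x * u x) * (u x * u' x + u' x * u x) + (u x * u' x + u' x * u x) * (u x * u x)) (at x within {a..b})"
        by (intro has_vector_derivative_mult u that)
      then show ?thesis
        by (simp add: power4_eq_xxxx power3_eq_cube algebra_simps)
    qed
    then have "norm (u y^4 - u z^4) \<le> D"
      unfolding D_def by (intro norm_diff_le_integral continuous_intros cu u' y that) auto
    then have "norm (u y^4) \<le> norm (u z^4) + D"
      using norm_triangle_ineq2[of "u y^4" "u z^4"] by linarith
    then show ?thesis by (simp add: norm_power)
  qed
  have "integral {a..b} (\<lambda>z. norm (u y)^4) \<le> integral {a..b} (\<lambda>z. norm (u z)^4 + D)"
    by (intro integral_le integrable_continuous_real continuous_intros cu *) auto
  also have "\<dots> = integral {a..b} (\<lambda>z. norm (u z)^4) + (b - a) * D"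
    using \<open>a < b\<close> by (subst integral_add) (auto intro!: integrable_continuous_real continuous_intros cu)
  also have "integral {a..b} (\<lambda>z. norm (u y)^4) = (b - a) * norm (u y)^4"
    using \<open>a < b\<close> by simp
  finally have 1: "norm (u y)^4 \<le> 1 / (b - a) * integral {a..b} (\<lambda>z. norm (u z)^4) + D"
    using \<open>a < b\<close> by (simp add: field_simps)
  have "D \<le> integral {a..b} (\<lambda>x. 3 * w * norm (u x)^4 + 1 / w^3 * norm (u' x)^4)"
    unfolding D_def
  proof (rule integral_le)
    show "norm (4 * u x^3 * u' x) \<le> 3 * w * norm (u x)^4 + 1 / w^3 * norm (u' x)^4" for x
      using cube_times_le[OF w, of "norm (u x)" "norm (u' x)"] by (simp add: norm_mult norm_power)
  qed (intro integrable_continuous_real continuous_intros cu u')+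
  also have "\<dots> = 3 * w * integral {a..b} (\<lambda>x. norm (u x)^4) + 1 / w^3 * integral {a..b} (\<lambda>x. norm (u' x)^4)"
    using w by (subst integral_add) (auto intro!: integrable_continuous_real continuous_intros cu u')
  finally show ?thesis
    using 1 by (simp add: algebra_simps)
qed

lemma sum_integral_subintervals:
  fixes f :: "real \<Rightarrow> real"
  assumes "continuous_on {0..1} f" "n \<ge> 1"
  shows "(\<Sum>i<n. integral {real i / real n..real (Suc i) / real n} f) = integral {0..1} f"
proof -
  have "(\<Sum>i<m. integral {real i / real n..real (Suc i) / real n} f) = integral {0..real m / real n} f" if "m \<le> n" for m
    using that
  proof (induction m)
    case (Suc m)
    have "f integrable_on {0..real (Suc m) / real n}"
      using Suc.prems assms
      by (intro integrable_continuous_real continuous_on_subset[OF assms(1)]) auto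
    then have "integral {0..real m / real n} f + integral {real m / real n..real (Suc m) / real n} f
        = integral {0..real (Suc m) / real n} f"
      by (intro Henstock_Kurzweil_Integration.integral_combine) (auto simp: divide_right_mono)
    then show ?case using Suc by simp
  qed simp
  from this[of n] show ?thesis using assms(2) by simp
qed

section \<open>Box counts of graphs\<close>

lemma is_box_prod_iff:
  "is_box s (B :: (real \<times> real) set) \<longleftrightarrow> (\<exists>a b. B = {a..a + s} \<times> {b..b + s})"
proof -
  have "cbox a (a + s *\<^sub>R One) = {fst a..fst a + s} \<times> {snd a..snd a + s}" for a :: "real \<times> real"
  proof -
    have "(One :: real \<times> real) = (1, 1)"
      by (simp add: sum_Basis_prod_eq)
    then show ?thesis
      by (cases a) (simp add: cbox_Pair_eq)
  qed
  then show ?thesis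
    by (auto simp: is_box_def)
qed

text \<open>Over the cell \<open>i\<close> the graph lies in a strip of height
  \<open>2 * r i\<close>, which is covered by a stack of boxes, one more than the integer part of
  \<open>2 * n * r i\<close>.\<close>

lemma graph_box_cover:
  fixes f r :: "_ \<Rightarrow> real"
  assumes n: "n \<ge> 1" and r: "\<And>i. i < n \<Longrightarrow> r i \<ge> 0"
    and f: "\<And>i y. i < n \<Longrightarrow> y \<in> {real i / real n..real (Suc i) / real n} \<Longrightarrow> \<bar>f y - f (real i / real n)\<bar> \<le> r i"
  shows "\<exists>\<B>. finite \<B> \<and> (\<forall>B\<in>\<B>. is_box (1 / real n) B) \<and> {(x, f x) | x. x \<in> {0..1}} \<subseteq> \<Union>\<B> \<and>
           real (card \<B>) \<le> (\<Sum>i<n. 2 * real n * r i + 1)"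
proof -
  define h where "h = 1 / real n"
  have h: "h > 0" using n by (simp add: h_def)
  define box where "box = (\<lambda>(i, j :: nat). {real i / real n..real i / real n + h} \<times>
     {f (real i / real n) - r i + real j * h..f (real i / real n) - r i + real j * h + h})"
  define I where "I = Sigma {..<n} (\<lambda>i. {..nat \<lfloor>2 * real n * r i\<rfloor>})"
  define \<B> where "\<B> = box ` I"
  have finI: "finite I" by (simp add: I_def)
  then have fin: "finite \<B>" by (simp add: \<B>_def)
  have boxes: "\<forall>B\<in>\<B>. is_box (1 / real n) B"
    by (auto simp: \<B>_def box_def is_box_prod_iff h_def)
  have cover: "(x, f x) \<in> \<Union>\<B>" if x: "x \<in> {0..1}" for x
  proof -
    obtain i where i: "i < n" "x \<in> {real i / real n..real (Suc i) / real n}"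
    \<comment> \<open>For \<open>x = 1\<close> the floor of \<open>x * n\<close> would be
      \<open>n\<close>, one past the last cell.\<close>
    proof (cases "x = 1")
      case True
      then show ?thesis using n that[of "n - 1"] by (simp add: of_nat_diff field_simps)
    next
      case False
      then have "nat \<lfloor>x * real n\<rfloor> < n"
        using x n by (simp add: nat_less_iff floor_less_iff)
      moreover have "real (nat \<lfloor>x * real n\<rfloor>) \<le> x * real n" "x * real n \<le> real (nat \<lfloor>x * real n\<rfloor>) + 1"
        using x n by (simp_all add: of_nat_nat)
      ultimately show ?thesis
        using n that[of "nat \<lfloor>x * real n\<rfloor>"] by (simp add: field_simps)
    qed
    define t where "t = f x - (f (real i / real n) - r i)"
    have t: "0 \<le> t" "t \<le> 2 * r i"
      using f[OF i] by (auto simp: t_def abs_le_iff)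
    define j where "j = nat \<lfloor>t * real n\<rfloor>"
    have j: "real j \<le> t * real n" "t * real n \<le> real j + 1"
      using t n by (simp_all add: j_def of_nat_nat)
    have "t * real n \<le> 2 * real n * r i"
      using t n by (simp add: mult.commute mult_left_mono)
    then have "j \<le> nat \<lfloor>2 * real n * r i\<rfloor>"
      unfolding j_def by (intro nat_mono floor_mono)
    then have "(i, j) \<in> I" using i by (simp add: I_def)
    moreover have "(x, f x) \<in> box (i, j)"
      using i j n by (auto simp: box_def t_def h_def field_simps)
    ultimately show ?thesis by (auto simp: \<B>_def)
  qed
  have "card \<B> \<le> card I"
    unfolding \<B>_def using finI by (rule card_image_le)
  also have "card I = (\<Sum>i<n. nat \<lfloor>2 * real n * r i\<rfloor> + 1)"
    by (simp add: I_def)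
  finally have "real (card \<B>) \<le> real (\<Sum>i<n. nat \<lfloor>2 * real n * r i\<rfloor> + 1)"
    by (rule of_nat_mono)
  also have "\<dots> = (\<Sum>i<n. real (nat \<lfloor>2 * real n * r i\<rfloor>) + 1)"
    by (simp add: add.commute)
  also have "\<dots> \<le> (\<Sum>i<n. 2 * real n * r i + 1)"
    using r by (intro sum_mono) (simp add: of_nat_nat)
  finally show ?thesis
    using fin boxes cover by blast
qed

lemma box_count_le:
  assumes "finite \<B>" "\<forall>B\<in>\<B>. is_box (1 / real n) B" "E \<subseteq> \<Union>\<B>"
  shows "box_count n E \<le> card \<B>"
  unfolding box_count_def by (rule Least_le) (use assms in blast)

text \<open>A value given by \<open>LEAST\<close> is attained only if some cover exists; the cover
  in the hypotheses provides this.\<close>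

lemma box_count_cover:
  assumes "finite \<B>" "\<forall>B\<in>\<B>. is_box (1 / real n) B" "E \<subseteq> \<Union>\<B>"
  obtains \<C> where "finite \<C>" "\<forall>B\<in>\<C>. is_box (1 / real n) B" "E \<subseteq> \<Union>\<C>" "card \<C> = box_count n E"
proof -
  define P where
    "P m \<longleftrightarrow> (\<exists>\<C>. finite \<C> \<and> card \<C> = m \<and> (\<forall>B\<in>\<C>. is_box (1 / real n) B) \<and> E \<subseteq> \<Union>\<C>)" for m
  have "P (card \<B>)" unfolding P_def using assms by blast
  then have "P (LEAST m. P m)" by (rule LeastI)
  moreover have "(LEAST m. P m) = box_count n E" by (simp add: P_def box_count_def)
  ultimately have "P (box_count n E)" by simp
  then show ?thesis using that unfolding P_def by blast
qed

text \<open>Used to see that a box of width \<open>1 / n\<close>, placed anywhere, touches at most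
  three closed cells of length \<open>1 / n\<close>.\<close>

lemma card_nat_near_le_3: "card {i. t - 1 \<le> real i \<and> real i \<le> t + 1} \<le> 3"
proof -
  have "int ` {i. t - 1 \<le> real i \<and> real i \<le> t + 1} \<subseteq> {\<lceil>t - 1\<rceil>..\<lfloor>t + 1\<rfloor>}"
    by auto linarith+
  then have "card (int ` {i. t - 1 \<le> real i \<and> real i \<le> t + 1}) \<le> card {\<lceil>t - 1\<rceil>..\<lfloor>t + 1\<rfloor>}"
    by (intro card_mono) auto
  also have "\<dots> \<le> 3"
    by simp linarith
  finally show ?thesis
    by (simp add: card_image)
qed

text \<open>By the intermediate value theorem \<open>f\<close> takes every value between
  \<open>f z\<close> and \<open>f y\<close> on the interval. The vertical projections of the boxes
  above it therefore cover this range of values, and each has length \<open>1 / n\<close>.\<close>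

lemma oscillation_le_card_boxes:
  fixes f :: "real \<Rightarrow> real"
  assumes n: "n \<ge> 1" and cont: "continuous_on {0..1} f"
    and \<B>: "finite \<B>" "\<forall>B\<in>\<B>. is_box (1 / real n) B" "{(x, f x) | x. x \<in> {0..1}} \<subseteq> \<Union>\<B>"
    and I: "{a..b} \<subseteq> {0..1}" and yz: "y \<in> {a..b}" "z \<in> {a..b}"
  shows "\<bar>f y - f z\<bar> \<le> real (card {B \<in> \<B>. \<exists>p\<in>B. fst p \<in> {a..b}}) / real n"
proof -
  define N where "N = {B \<in> \<B>. \<exists>p\<in>B. fst p \<in> {a..b}}"
  have finN: "finite N" using \<B>(1) by (simp add: N_def)
  have "\<forall>B\<in>\<B>. \<exists>\<beta>. snd ` B \<subseteq> {\<beta>..\<beta> + 1 / real n}"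
  proof
    fix B assume "B \<in> \<B>"
    then obtain a b where "B = {a..a + 1 / real n} \<times> {b..b + 1 / real n}"
      using \<B>(2) unfolding is_box_prod_iff by blast
    then have "snd ` B \<subseteq> {b..b + 1 / real n}" by auto
    then show "\<exists>\<beta>. snd ` B \<subseteq> {\<beta>..\<beta> + 1 / real n}" by blast
  qed
  then obtain \<beta> where \<beta>: "\<And>B. B \<in> \<B> \<Longrightarrow> snd ` B \<subseteq> {\<beta> B..\<beta> B + 1 / real n}"
    unfolding bchoice_iff by blast
  have *: "\<bar>f y - f z\<bar> \<le> real (card N) / real n" if le: "f z \<le> f y" and yz: "y \<in> {a..b}" "z \<in> {a..b}" for y z
  proof -
    have "{f z..f y} \<subseteq> (\<Union>B\<in>N. {\<beta> B..\<beta> B + 1 / real n})"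
    proof
      fix v assume v: "v \<in> {f z..f y}"
      have "connected (f ` {a..b})"
        using cont I by (intro connected_continuous_image) (auto intro: continuous_on_subset)
      then have "{f z..f y} \<subseteq> f ` {a..b}"
        using yz by (intro connected_contains_Icc) auto
      then obtain x where x: "x \<in> {a..b}" "v = f x" using v by auto
      then have "x \<in> {0..1}" using I by blast
      then have "(x, f x) \<in> \<Union>\<B>" using \<B>(3) by blast
      then obtain B where B: "B \<in> \<B>" "(x, f x) \<in> B" by auto
      then have "B \<in> N" using x by (force simp: N_def)
      moreover have "v \<in> {\<beta> B..\<beta> B + 1 / real n}"
        using \<beta>[OF B(1)] B(2) x by force
      ultimately show "v \<in> (\<Union>B\<in>N. {\<beta> B..\<beta> B + 1 / real n})" by blast
    qed
    then have "measure lborel {f z..f y} \<le> measure lborel (\<Union>B\<in>N. {\<beta> B..\<beta> B + 1 / real n})"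
      using finN by (intro measure_mono_fmeasurable fmeasurable.finite_UN) (auto simp: fmeasurable_def)
    also have "\<dots> \<le> (\<Sum>B\<in>N. measure lborel {\<beta> B..\<beta> B + 1 / real n})"
      using finN by (intro measure_UNION_le) auto
    also have "\<dots> = real (card N) / real n"
      by simp
    finally show ?thesis using le by simp
  qed
  show ?thesis
    using *[of z y] *[of y z] yz unfolding N_def[symmetric]
    by (cases "f z \<le> f y") (auto simp: abs_minus_commute)
qed

text \<open>An increment over \<open>1 / n\<close> is at most the sum of the oscillations on two
  adjacent cells, each bounded by the number of boxes there over \<open>n\<close>. Every cell is
  used twice and every box meets at most three cells, whence the factor 6. One factor
  \<open>1 / n\<close> is the height of a box, the other the length of a cell.\<close>

lemma integral_increment_le_box_count:
  fixes f :: "real \<Rightarrow> real"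
  assumes n: "n \<ge> 1" and cont: "continuous_on UNIV f" and periodic: "\<And>x. f (x + 1) = f x"
  shows "integral {0..1} (\<lambda>x. \<bar>f (x + 1 / real n) - f x\<bar>)
    \<le> 6 * real (box_count n {(x, f x) | x. x \<in> {0..1}}) / real n^2"
proof -
  define h where "h = 1 / real n"
  have h: "h > 0" "real n * h = 1" using n by (simp_all add: h_def)
  define E where "E = {(x, f x) | x. x \<in> {0..1}}"
  have contI: "continuous_on X f" for X using cont continuous_on_subset by blast
  have "bounded (f ` {0..1})"
    by (intro compact_imp_bounded compact_continuous_image contI) auto
  then obtain K where "\<forall>y\<in>f ` {0..1}. norm y \<le> K"
    unfolding bounded_iff by blast
  then have K: "\<bar>f x\<bar> \<le> K" if "x \<in> {0..1}" for x
    using that by simp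
  have K0: "K \<ge> 0" using K[of 0] by auto
  have cells: "{real i / real n..real (Suc i) / real n} \<subseteq> {0..1}" if "i < n" for i
    using that n by (auto simp: field_simps)
  \<comment> \<open>A crude cover, from the boundedness of \<open>f\<close>, so that the minimum in
    \<open>box_count\<close> is attained.\<close>
  have "\<exists>\<B>. finite \<B> \<and> (\<forall>B\<in>\<B>. is_box (1 / real n) B) \<and> E \<subseteq> \<Union>\<B> \<and>
           real (card \<B>) \<le> (\<Sum>i<n. 2 * real n * (2 * K) + 1)"
    unfolding E_def
  proof (rule graph_box_cover)
    fix i y assume i: "i < n" "y \<in> {real i / real n..real (Suc i) / real n}"
    have "real i / real n \<in> {real i / real n..real (Suc i) / real n}"
      by (simp add: divide_right_mono)
    then have "y \<in> {0..1}" "real i / real n \<in> {0..1}"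
      using cells[OF i(1)] i(2) by blast+
    then have "\<bar>f y\<bar> \<le> K" "\<bar>f (real i / real n)\<bar> \<le> K"
      using K by blast+
    then show "\<bar>f y - f (real i / real n)\<bar> \<le> 2 * K" by linarith
  qed (use n K0 in auto)
  then obtain \<A> where \<A>: "finite \<A>" "\<forall>B\<in>\<A>. is_box (1 / real n) B" "E \<subseteq> \<Union>\<A>"
    by blast
  obtain \<B> where \<B>: "finite \<B>" "\<forall>B\<in>\<B>. is_box (1 / real n) B" "E \<subseteq> \<Union>\<B>" "card \<B> = box_count n E"
    by (rule box_count_cover[OF \<A>])
  define P where "P i B \<longleftrightarrow> (\<exists>p\<in>B. fst p \<in> {real i / real n..real (Suc i) / real n})" for i and B :: "(real \<times> real) set"
  define N where "N i = real (card {B \<in> \<B>. P i B})" for i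
  \<comment> \<open>For \<open>x\<close> in the last cell the point \<open>x + h\<close> lies in the
    cell \<open>n\<close>, outside \<open>{0..1}\<close>; periodicity identifies it with the cell
    0.\<close>
  define N' where "N' i = (if i < n then N i else N 0)" for i
  have osc: "\<bar>f y - f z\<bar> \<le> N i * h"
    if "i < n" "y \<in> {real i / real n..real (Suc i) / real n}" "z \<in> {real i / real n..real (Suc i) / real n}" for i y z
    using oscillation_le_card_boxes[OF n contI \<B>(1,2) _ cells[OF that(1)] that(2,3)] \<B>(3)
    by (simp add: N_def P_def E_def h_def)
  have osc': "\<bar>f y - f z\<bar> \<le> N' i * h"
    if i: "i \<le> n" and yz: "y \<in> {real i / real n..real (Suc i) / real n}" "z \<in> {real i / real n..real (Suc i) / real n}" for i y z
  proof (cases "i < n")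
    case True
    then show ?thesis using osc yz by (simp add: N'_def)
  next
    case False
    then have "i = n" using i by simp
    have "\<bar>f (y - 1) - f (z - 1)\<bar> \<le> N 0 * h"
      using n yz by (intro osc) (auto simp: \<open>i = n\<close> field_simps)
    then show ?thesis
      using periodic[of "y - 1"] periodic[of "z - 1"] by (simp add: N'_def \<open>i = n\<close>)
  qed
  have cont_incr: "continuous_on X (\<lambda>x. \<bar>f (x + h) - f x\<bar>)" for X
    by (intro continuous_intros continuous_on_compose2[OF cont]) auto
  have cell: "integral {real i / real n..real (Suc i) / real n} (\<lambda>x. \<bar>f (x + h) - f x\<bar>) \<le> h * ((N' i + N' (Suc i)) * h)"
    if "i < n" for i
  proof -
    have "integral {real i / real n..real (Suc i) / real n} (\<lambda>x. \<bar>f (x + h) - f x\<bar>)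
        \<le> integral {real i / real n..real (Suc i) / real n} (\<lambda>x. (N' i + N' (Suc i)) * h)"
    proof (rule integral_le)
      fix x assume x: "x \<in> {real i / real n..real (Suc i) / real n}"
      \<comment> \<open>The common endpoint of the cell that contains \<open>x\<close> and the next
        one, which contains \<open>x + h\<close>.\<close>
      define m where "m = real (Suc i) / real n"
      have "\<bar>f m - f x\<bar> \<le> N' i * h"
        using x that n by (intro osc') (auto simp: m_def divide_right_mono)
      moreover have "\<bar>f (x + h) - f m\<bar> \<le> N' (Suc i) * h"
        using x that n by (intro osc') (auto simp: m_def h_def add_divide_distrib)
      ultimately show "\<bar>f (x + h) - f x\<bar> \<le> (N' i + N' (Suc i)) * h"
        by (simp add: distrib_right)
    qed (intro integrable_continuous_real cont_incr continuous_intros)+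
    also have "\<dots> = h * ((N' i + N' (Suc i)) * h)"
      using n by (simp add: h_def field_simps)
    finally show ?thesis .
  qed
  have "integral {0..1} (\<lambda>x. \<bar>f (x + h) - f x\<bar>)
      = (\<Sum>i<n. integral {real i / real n..real (Suc i) / real n} (\<lambda>x. \<bar>f (x + h) - f x\<bar>))"
    using n cont_incr by (intro sum_integral_subintervals[symmetric])
  also have "\<dots> \<le> (\<Sum>i<n. h * ((N' i + N' (Suc i)) * h))"
    using cell by (intro sum_mono) auto
  also have "\<dots> = h^2 * ((\<Sum>i<n. N' i) + (\<Sum>i<n. N' (Suc i)))"
    by (simp add: sum_distrib_left sum_distrib_right sum.distrib[symmetric] power2_eq_square ac_simps)
  also have "(\<Sum>i<n. N' (Suc i)) = (\<Sum>i<n. N' i)"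
  proof -
    have "N' 0 + (\<Sum>i<n. N' (Suc i)) = (\<Sum>i<n. N' i) + N' n"
      using sum.lessThan_Suc[of N' n] sum.lessThan_Suc_shift[of N' n] by simp
    moreover have "N' 0 = N' n" using n by (simp add: N'_def)
    ultimately show ?thesis by simp
  qed
  also have "(\<Sum>i<n. N' i) = (\<Sum>i<n. N i)"
    by (simp add: N'_def)
  also have "(\<Sum>i<n. N i) = (\<Sum>i<n. \<Sum>B\<in>\<B>. if P i B then 1 else 0)"
    using \<B>(1) by (simp add: N_def sum.If_cases Int_def)
  also have "\<dots> = (\<Sum>B\<in>\<B>. \<Sum>i<n. if P i B then 1 else 0)"
    by (rule sum.swap)
  also have "\<dots> \<le> (\<Sum>B\<in>\<B>. 3)"
  proof (intro sum_mono)
    fix B assume "B \<in> \<B>"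
    then obtain a b where B: "B = {a..a + h} \<times> {b..b + h}"
      using \<B>(2) by (auto simp: is_box_prod_iff h_def)
    have "(\<Sum>i<n. if P i B then 1 else 0) = real (card ({..<n} \<inter> {i. P i B}))"
      by (simp add: sum.If_cases)
    also have "\<dots> \<le> real (card {i. real n * a - 1 \<le> real i \<and> real i \<le> real n * a + 1})"
    proof (intro of_nat_mono card_mono)
      show "finite {i. real n * a - 1 \<le> real i \<and> real i \<le> real n * a + 1}"
        by (rule finite_subset[of _ "{..nat \<lceil>real n * a + 1\<rceil>}"]) (auto simp: le_nat_iff le_ceiling_iff, linarith)
      show "{..<n} \<inter> {i. P i B} \<subseteq> {i. real n * a - 1 \<le> real i \<and> real i \<le> real n * a + 1}"
      proof clarify
        fix i assume "P i B"
        then obtain x where "a \<le> x" "x \<le> a + h" "real i / real n \<le> x" "x \<le> real (Suc i) / real n"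
          by (auto simp: P_def B)
        then have "real i / real n \<le> a + h" "a \<le> real (Suc i) / real n" by linarith+
        then show "real n * a - 1 \<le> real i \<and> real i \<le> real n * a + 1"
          using n by (simp add: h_def field_simps)
      qed
    qed
    also have "\<dots> \<le> 3"
      using card_nat_near_le_3[of "real n * a"] by linarith
    finally show "(\<Sum>i<n. if P i B then 1 else 0) \<le> (3 :: real)" .
  qed
  also have "\<dots> = 3 * real (box_count n E)"
    by (simp add: \<B>(4))
  finally have "integral {0..1} (\<lambda>x. \<bar>f (x + h) - f x\<bar>)
      \<le> h^2 * (3 * real (box_count n E) + 3 * real (box_count n E))"
    by this (auto intro!: mult_right_mono)
  then show ?thesis
    unfolding E_def[symmetric] h_def by (simp add: power_divide)
qed

section \<open>The series and its truncations\<close>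

text \<open>The integral test in telescoping form, from the mean value theorem for
  \<open>z powr (- \<delta>)\<close>.\<close>

lemma powr_tail_term_le:
  fixes \<delta> x :: real
  assumes "\<delta> > 0" "x > 0"
  shows "(x + 1) powr (- 1 - \<delta>) \<le> (x powr (- \<delta>) - (x + 1) powr (- \<delta>)) / \<delta>"
proof -
  have "\<exists>z. x < z \<and> z < x + 1 \<and>
      (x + 1) powr (- \<delta>) - x powr (- \<delta>) = (x + 1 - x) * ((- \<delta>) * z powr (- \<delta> - 1))"
  proof (rule MVT2)
    fix z assume "x \<le> z" "z \<le> x + 1"
    then show "((\<lambda>z. z powr (- \<delta>)) has_real_derivative (- \<delta>) * z powr (- \<delta> - 1)) (at z)"
      using assms by (intro has_real_derivative_powr) auto
  qed simp
  then obtain z where z: "x < z" "z < x + 1"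
    and eq: "x powr (- \<delta>) - (x + 1) powr (- \<delta>) = \<delta> * z powr (- \<delta> - 1)"
    by auto
  have "- 1 - \<delta> = - \<delta> - 1" by simp
  then have "(x + 1) powr (- 1 - \<delta>) = (x + 1) powr (- \<delta> - 1)"
    by (simp only:)
  also have "\<dots> \<le> z powr (- \<delta> - 1)"
    using z assms by (intro powr_mono2') auto
  also have "\<dots> = (x powr (- \<delta>) - (x + 1) powr (- \<delta>)) / \<delta>"
    using assms by (simp add: eq)
  finally show ?thesis .
qed

lemma powr_tail_sums:
  assumes "\<delta> > 0" "T \<ge> 1"
  shows "summable (\<lambda>n. real (Suc (n + T)) powr (- 1 - \<delta>))"
    and "(\<Sum>n. real (Suc (n + T)) powr (- 1 - \<delta>)) \<le> real T powr (- \<delta>) / \<delta>"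
proof -
  define f where "f n = real (n + T) powr (- \<delta>) / \<delta>" for n
  have "(\<lambda>n. f n) \<longlonglongrightarrow> 0"
  proof -
    have "filterlim (\<lambda>n. real (n + T)) at_top sequentially"
      by real_asymp
    then have "(\<lambda>n. real (n + T) powr (- \<delta>)) \<longlonglongrightarrow> 0"
      using assms by (intro tendsto_neg_powr) auto
    then show ?thesis unfolding f_def using tendsto_divide_0 by (auto intro: tendsto_divide_zero)
  qed
  then have sums: "(\<lambda>n. f n - f (Suc n)) sums (f 0 - 0)"
    by (rule telescope_sums')
  have le: "real (Suc (n + T)) powr (- 1 - \<delta>) \<le> f n - f (Suc n)" for n
    using powr_tail_term_le[OF assms(1), of "real (n + T)"] assms(2)
    by (simp add: f_def diff_divide_distrib add.commute)
  show s: "summable (\<lambda>n. real (Suc (n + T)) powr (- 1 - \<delta>))"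
    by (rule summable_comparison_test'[OF sums_summable[OF sums]]) (use le in auto)
  have "(\<Sum>n. real (Suc (n + T)) powr (- 1 - \<delta>)) \<le> (\<Sum>n. f n - f (Suc n))"
    by (intro suminf_le le s sums_summable[OF sums])
  also have "\<dots> = real T powr (- \<delta>) / \<delta>"
    using sums_unique[OF sums] by (simp add: f_def)
  finally show "(\<Sum>n. real (Suc (n + T)) powr (- 1 - \<delta>)) \<le> real T powr (- \<delta>) / \<delta>" .
qed

locale trig_series =
  fixes \<delta> :: real and K :: nat and C :: "int \<Rightarrow> complex" and g :: "real \<Rightarrow> real"
  assumes delta: "0 < \<delta>" "\<delta> \<le> 1"
    and trig: "real_trig_poly K C g" and C0: "C 0 = 0"
begin

definition freqs :: "int set" where "freqs = {- int K..int K} - {0}"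

text \<open>The sum of the norms rather than their maximum, so that it bounds \<open>g\<close>
  itself as well as every coefficient.\<close>

definition Cmax :: real where "Cmax = (\<Sum>k\<in>freqs. norm (C k))"

definition coef :: "int \<Rightarrow> nat \<Rightarrow> complex" where
  "coef k n = C k * of_real (real n powr (- 1 - \<delta>))"

lemma freqs: "finite freqs" "0 \<notin> freqs"
  by (auto simp: freqs_def)

lemma abs_freqs_le: "k \<in> freqs \<Longrightarrow> \<bar>of_int k\<bar> \<le> real K"
  by (auto simp: freqs_def abs_le_iff)

lemma Cmax_nonneg: "Cmax \<ge> 0"
  by (simp add: Cmax_def sum_nonneg)

lemma norm_C_le: "k \<in> freqs \<Longrightarrow> norm (C k) \<le> Cmax"
  unfolding Cmax_def using freqs by (intro member_le_sum) auto

lemma g_eq: "of_real (g x) = (\<Sum>k\<in>freqs. C k * echar (of_int k * x))"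
proof -
  have "of_real (g x) = (\<Sum>k = - int K..int K. C k * echar (of_int k * x))"
    using trig by (simp add: real_trig_poly_def echar_def cis_conv_exp ac_simps)
  also have "\<dots> = (\<Sum>k\<in>freqs. C k * echar (of_int k * x))"
    unfolding freqs_def by (rule sum.mono_neutral_right) (auto simp: C0)
  finally show ?thesis .
qed

lemma abs_g_le: "\<bar>g x\<bar> \<le> Cmax"
proof -
  have "\<bar>g x\<bar> = norm (\<Sum>k\<in>freqs. C k * echar (of_int k * x))"
    by (metis g_eq norm_of_real)
  also have "\<dots> \<le> Cmax"
    unfolding Cmax_def by (intro sum_norm_le) (simp add: norm_mult)
  finally show ?thesis .
qed

lemma g_periodic: "g (x + of_int m) = g x"
proof -
  have "echar (of_int k * (x + of_int m)) = echar (of_int k * x)" for k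
    using echar_int[of "k * m"] by (simp add: distrib_left echar_add)
  then have "complex_of_real (g (x + of_int m)) = of_real (g x)"
    by (simp add: g_eq)
  then show ?thesis by simp
qed

abbreviation "term x n \<equiv> g ((real (Suc n))\<^sup>2 * x) * real (Suc n) powr (- 1 - \<delta>)"

lemma G_periodic: "G \<delta> g (x + 1) = G \<delta> g x"
proof -
  have "g ((real (Suc n))\<^sup>2 * (x + 1)) = g ((real (Suc n))\<^sup>2 * x)" for n
    using g_periodic[of "(real (Suc n))\<^sup>2 * x" "(int (Suc n))\<^sup>2"] by (simp add: distrib_left)
  then show ?thesis by (simp add: G_def)
qed

lemma abs_term_le: "\<bar>term x n\<bar> \<le> Cmax * real (Suc n) powr (- 1 - \<delta>)"
  using abs_g_le by (simp add: abs_mult mult_right_mono)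

lemma summable_bound: "summable (\<lambda>n. Cmax * real (Suc n) powr (- 1 - \<delta>))"
proof -
  have "summable (\<lambda>n. real (Suc (Suc n)) powr (- 1 - \<delta>))"
    using powr_tail_sums(1)[OF delta(1), of 1] by simp
  then have "summable (\<lambda>n. real (Suc n) powr (- 1 - \<delta>))"
    by (rule summable_Suc_iff[THEN iffD1])
  then show ?thesis by (rule summable_mult)
qed

lemma trig_sum_coef_eq: "trig_sum coef freqs A x = of_real (\<Sum>n\<in>A. g ((real n)\<^sup>2 * x) * real n powr (- 1 - \<delta>))"
proof -
  have "trig_sum coef freqs A x = (\<Sum>n\<in>A. \<Sum>k\<in>freqs. coef k n * echar (of_int k * (real n)\<^sup>2 * x))"
    unfolding trig_sum_def by (rule sum.swap)
  also have "\<dots> = (\<Sum>n\<in>A. of_real (g ((real n)\<^sup>2 * x)) * of_real (real n powr (- 1 - \<delta>)))"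
    by (intro sum.cong refl) (simp add: g_eq coef_def sum_distrib_left ac_simps)
  finally show ?thesis by simp
qed

lemma norm_G_diff_trig_sum_le:
  assumes "T \<ge> 1"
  shows "norm (of_real (G \<delta> g x) - trig_sum coef freqs {1..T} x) \<le> Cmax / \<delta> * real T powr (- \<delta>)"
proof -
  have sm: "summable (term x)"
    by (rule summable_comparison_test'[OF summable_bound, of 0], unfold real_norm_def, rule abs_term_le)
  have "(\<Sum>n\<in>{1..T}. g ((real n)\<^sup>2 * x) * real n powr (- 1 - \<delta>)) = (\<Sum>n<T. term x n)"
    using sum.atLeast1_atMost_eq[of "\<lambda>n. g ((real n)\<^sup>2 * x) * real n powr (- 1 - \<delta>)" T] by simp
  moreover have "G \<delta> g x = (\<Sum>n. term x (n + T)) + (\<Sum>n<T. term x n)"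
    unfolding G_def by (rule suminf_split_initial_segment[OF sm])
  ultimately have eq: "of_real (G \<delta> g x) - trig_sum coef freqs {1..T} x = of_real (\<Sum>n. term x (n + T))"
    by (simp add: trig_sum_coef_eq)
  have s: "summable (\<lambda>n. Cmax * real (Suc (n + T)) powr (- 1 - \<delta>))"
    using powr_tail_sums(1)[OF delta(1) assms] by (rule summable_mult)
  have "\<bar>\<Sum>n. term x (n + T)\<bar> \<le> (\<Sum>n. Cmax * real (Suc (n + T)) powr (- 1 - \<delta>))"
    unfolding real_norm_def[symmetric]
    by (rule norm_suminf_le[OF _ s], unfold real_norm_def, rule abs_term_le)
  also have "\<dots> = Cmax * (\<Sum>n. real (Suc (n + T)) powr (- 1 - \<delta>))"
    using powr_tail_sums(1)[OF delta(1) assms] by (rule suminf_mult)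
  also have "\<dots> \<le> Cmax * (real T powr (- \<delta>) / \<delta>)"
    using powr_tail_sums(2)[OF delta(1) assms] Cmax_nonneg by (intro mult_left_mono)
  finally show ?thesis unfolding eq norm_of_real by simp
qed

lemma continuous_G: "continuous_on UNIV (G \<delta> g)"
proof -
  have ul: "uniform_limit UNIV (\<lambda>n x. \<Sum>i<n. term x i) (\<lambda>x. suminf (term x)) sequentially"
    by (rule Weierstrass_m_test[OF _ summable_bound], unfold real_norm_def, rule abs_term_le)
  have "continuous_on UNIV (\<lambda>x. Re (\<Sum>k\<in>freqs. C k * echar (of_int k * x)))"
    by (intro continuous_intros)
  then have "continuous_on UNIV g"
    by (simp add: g_eq[symmetric])
  then have cont_term: "continuous_on UNIV (\<lambda>x. g ((real (Suc i))\<^sup>2 * x))" for i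
    by (rule continuous_on_compose2) (auto intro!: continuous_intros)
  have "continuous_on UNIV (\<lambda>x. \<Sum>i<n. term x i)" for n
    by (intro continuous_on_sum continuous_on_mult continuous_on_const cont_term)
  then have ev: "\<forall>\<^sub>F n in sequentially. continuous_on UNIV (\<lambda>x. \<Sum>i<n. term x i)"
    by (intro always_eventually allI)
  have "continuous_on UNIV (\<lambda>x. suminf (term x))"
    by (rule uniform_limit_theorem[OF ev ul]) simp
  then show ?thesis unfolding G_def .
qed

end

section \<open>Fourth moments and oscillations\<close>

lemma trig_sum_union:
  assumes "finite A" "finite B" "A \<inter> B = {}"
  shows "trig_sum c S (A \<union> B) x = trig_sum c S A x + trig_sum c S B x"
  unfolding trig_sum_def using assms by (simp add: sum.union_disjoint sum.distrib)

lemma trig_sum_dyadic: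
  "trig_sum c S {1..2^J * M} x
     = trig_sum c S {1..M} x + (\<Sum>j<J. trig_sum c S {2^j * M<..2 * (2^j * M)} x)"
proof (induction J)
  case (Suc J)
  have "{1..2^Suc J * M} = {1..2^J * M} \<union> {2^J * M<..2 * (2^J * M)}"
    by auto
  then have "trig_sum c S {1..2^Suc J * M} x
      = trig_sum c S {1..2^J * M} x + trig_sum c S {2^J * M<..2 * (2^J * M)} x"
    by (simp only: trig_sum_union[OF finite_atLeastAtMost finite_greaterThanAtMost] ivl_disj_int)
  with Suc show ?case by simp
qed simp

text \<open>Substitutes for Hoelder in passing from fourth moments to first moments; it loses only a
  constant if \<open>\<tau>\<close> is the typical size of \<open>t\<close>.\<close>

lemma le_add_power4_div: "t \<le> \<tau> + t^4 / \<tau>^3" if "\<tau> > 0" "t \<ge> 0" for t \<tau> :: real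
proof (cases "t \<le> \<tau>")
  case True
  have "t^4 / \<tau>^3 \<ge> 0" using that by simp
  with True show ?thesis by linarith
next
  case False
  then have "t * \<tau>^3 \<le> t * t^3"
    using that by (intro mult_left_mono power_mono) auto
  then have "t \<le> t^4 / \<tau>^3"
    using that by (simp add: field_simps power4_eq_xxxx power3_eq_cube)
  then show ?thesis using that by linarith
qed

lemma integral_norm_le_power4:
  fixes u :: "real \<Rightarrow> complex"
  assumes u: "continuous_on {0..1} u" and E: "integral {0..1} (\<lambda>x. norm (u x)^4) \<le> E" and \<tau>: "\<tau> > 0"
  shows "integral {0..1} (\<lambda>x. norm (u x)) \<le> \<tau> + E / \<tau>^3"
proof -
  have "integral {0..1} (\<lambda>x. norm (u x)) \<le> integral {0..1} (\<lambda>x. \<tau> + norm (u x)^4 / \<tau>^3)"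
    using \<tau> by (intro integral_le integrable_continuous_real continuous_intros u le_add_power4_div) auto
  also have "\<dots> = \<tau> + integral {0..1} (\<lambda>x. norm (u x)^4) / \<tau>^3"
    using \<tau> by (subst integral_add) (auto intro!: integrable_continuous_real continuous_intros u)
  also have "\<dots> \<le> \<tau> + E / \<tau>^3"
    using \<tau> E by (intro add_left_mono divide_right_mono) auto
  finally show ?thesis .
qed

definition cell :: "nat \<Rightarrow> nat \<Rightarrow> real set" where
  "cell n i = {real i / real n..real (Suc i) / real n}"

lemma left_in_cell: "real i / real n \<in> cell n i"
  by (simp add: cell_def divide_right_mono)

text \<open>For low frequencies the oscillation on a cell is at most the integral of
  \<open>norm u'\<close> there, and these integrals add up to the one over \<open>{0..1}\<close>. A
  bound \<open>R i\<close> with the required property takes the place of a supremum.\<close>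

lemma low_oscillation_sum:
  fixes u u' :: "real \<Rightarrow> complex"
  assumes u: "\<And>x X. (u has_vector_derivative u' x) (at x within X)" and u': "continuous_on UNIV u'"
    and E: "integral {0..1} (\<lambda>x. norm (u' x)^4) \<le> E" and \<tau>: "\<tau> > 0" and n: "n \<ge> 1"
  shows "\<exists>R. (\<forall>i<n. 0 \<le> R i \<and> (\<forall>y\<in>cell n i. norm (u y - u (real i / real n)) \<le> R i)) \<and>
    (\<Sum>i<n. R i) \<le> \<tau> + E / \<tau>^3"
proof -
  define R where "R i = integral (cell n i) (\<lambda>x. norm (u' x))" for i
  have c: "continuous_on X u'" for X using u' continuous_on_subset by blast
  have "norm (u y - u (real i / real n)) \<le> R i" if "y \<in> cell n i" for i y
    using that left_in_cell[of i n] unfolding R_def cell_def by (intro norm_diff_le_integral u c)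
  moreover have "0 \<le> R i" for i
    unfolding R_def by (intro integral_nonneg) (auto simp: cell_def intro!: integrable_continuous_real continuous_intros c)
  moreover have "(\<Sum>i<n. R i) = integral {0..1} (\<lambda>x. norm (u' x))"
    unfolding R_def cell_def by (intro sum_integral_subintervals n continuous_intros c)
  moreover have "\<dots> \<le> \<tau> + E / \<tau>^3"
    by (intro integral_norm_le_power4 c E \<tau>)
  ultimately show ?thesis by (intro exI[of _ R]) auto
qed

text \<open>For high frequencies nothing is gained from subtracting, so \<open>u\<close> itself is
  bounded on each cell by the Sobolev inequality, and the leading 2 accounts for the two points. The
  factor \<open>real n\<close> inside is the reciprocal of the length of a cell.\<close>

lemma high_oscillation_sum:
  fixes u u' :: "real \<Rightarrow> complex"
  assumes u: "\<And>x X. (u has_vector_derivative u' x) (at x within X)" and u': "continuous_on UNIV u'"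
    and cu: "continuous_on UNIV u"
    and E: "integral {0..1} (\<lambda>x. norm (u x)^4) \<le> E" "integral {0..1} (\<lambda>x. norm (u' x)^4) \<le> E'"
    and \<tau>: "\<tau> > 0" and w: "w > 0" and n: "n \<ge> 1"
  shows "\<exists>R. (\<forall>i<n. 0 \<le> R i \<and> (\<forall>y\<in>cell n i. norm (u y - u (real i / real n)) \<le> R i)) \<and>
    (\<Sum>i<n. R i) \<le> 2 * (real n * \<tau> + ((real n + 3 * w) * E + E' / w^3) / \<tau>^3)"
proof -
  define V where "V i = (real n + 3 * w) * integral (cell n i) (\<lambda>x. norm (u x)^4)
      + 1 / w^3 * integral (cell n i) (\<lambda>x. norm (u' x)^4)" for i
  define R where "R i = 2 * (\<tau> + V i / \<tau>^3)" for i
  have c: "continuous_on X u'" "continuous_on X u" for X using u' cu continuous_on_subset by blast+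
  have V: "norm (u y)^4 \<le> V i" if "y \<in> cell n i" for i y
  proof -
    have len: "real (Suc i) / real n - real i / real n = 1 / real n"
      by (simp add: add_divide_distrib)
    have "norm (u y)^4 \<le> (1 / (real (Suc i) / real n - real i / real n) + 3 * w) * integral (cell n i) (\<lambda>x. norm (u x)^4)
      + 1 / w^3 * integral (cell n i) (\<lambda>x. norm (u' x)^4)"
      using that n unfolding cell_def by (intro norm_power4_le_integral u c w) (auto simp: divide_strict_right_mono)
    then show ?thesis unfolding V_def len by simp
  qed
  have nu: "norm (u y) \<le> \<tau> + V i / \<tau>^3" if "y \<in> cell n i" for i y
    using le_add_power4_div[OF \<tau>, of "norm (u y)"] divide_right_mono[OF V[OF that], of "\<tau>^3"] \<tau> by simp
  have "norm (u y - u (real i / real n)) \<le> R i" if "y \<in> cell n i" for i y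
    using nu[OF that] nu[OF left_in_cell[of i n]] norm_triangle_ineq4[of "u y" "u (real i / real n)"]
    by (simp add: R_def)
  moreover have "0 \<le> R i" for i
    using order_trans[OF norm_ge_zero nu[OF left_in_cell[of i n]]] by (simp add: R_def)
  moreover have "(\<Sum>i<n. R i) \<le> 2 * (real n * \<tau> + ((real n + 3 * w) * E + E' / w^3) / \<tau>^3)"
  proof -
    have "(\<Sum>i<n. V i) = (real n + 3 * w) * (\<Sum>i<n. integral (cell n i) (\<lambda>x. norm (u x)^4))
      + 1 / w^3 * (\<Sum>i<n. integral (cell n i) (\<lambda>x. norm (u' x)^4))"
      by (simp add: V_def sum.distrib sum_distrib_left)
    also have "(\<Sum>i<n. integral (cell n i) (\<lambda>x. norm (u x)^4)) = integral {0..1} (\<lambda>x. norm (u x)^4)"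
      unfolding cell_def by (intro sum_integral_subintervals n continuous_intros c)
    also have "(\<Sum>i<n. integral (cell n i) (\<lambda>x. norm (u' x)^4)) = integral {0..1} (\<lambda>x. norm (u' x)^4)"
      unfolding cell_def by (intro sum_integral_subintervals n continuous_intros c)
    also have "(real n + 3 * w) * integral {0..1} (\<lambda>x. norm (u x)^4) + 1 / w^3 * integral {0..1} (\<lambda>x. norm (u' x)^4)
        \<le> (real n + 3 * w) * E + 1 / w^3 * E'"
      using w E by (intro add_mono mult_left_mono) auto
    finally have le: "(\<Sum>i<n. V i) / \<tau>^3 \<le> ((real n + 3 * w) * E + E' / w^3) / \<tau>^3"
      using \<tau> by (intro divide_right_mono) auto
    have eq: "(\<Sum>i<n. R i) = 2 * (real n * \<tau> + (\<Sum>i<n. V i) / \<tau>^3)"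
      by (simp add: R_def sum.distrib sum_divide_distrib sum_distrib_left)
    show ?thesis unfolding eq by (intro mult_left_mono add_left_mono le) auto
  qed
  ultimately show ?thesis by (intro exI[of _ R]) auto
qed

section \<open>Fourth moments of the pieces of the series, of their derivatives and of their
  increments\<close>

context trig_series
begin

text \<open>One constant for the coefficients, their derivatives and their increments. In
  \<open>8 * pi\<close> the \<open>2 * pi\<close> comes from differentiation and the 4 from
  \<open>(2 * m)^2\<close> on a dyadic block.\<close>

definition Umax :: real where "Umax = 8 * pi * (real K + 1) * (Cmax + 1)"

text \<open>Here \<open>68 = 4 * 17\<close>: 17 is the constant in the count of
  \<open>square_quads\<close>, and the 4 appears when \<open>M\<close> is the end
  \<open>2 * m\<close> of a dyadic block.\<close>

definition L4const :: real where "L4const = 68 * real (card freqs)^4 * Umax^4"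

abbreviation "deriv_coef \<equiv> (\<lambda>k n. 2 * of_real pi * \<i> * of_int k * (of_nat n)^2 * coef k n)"

abbreviation "diff_coef h \<equiv> (\<lambda>k n. coef k n * (echar (of_int k * (real n)^2 * h) - 1))"

lemma L4const_nonneg: "L4const \<ge> 0"
  by (simp add: L4const_def)

lemma Cmax_bounds_Umax:
  assumes "k \<in> freqs"
  shows "2 * Cmax \<le> Umax" "8 * pi * \<bar>of_int k\<bar> * Cmax \<le> Umax"
proof -
  have "2 * 1 * Cmax \<le> (8 * pi) * (real K + 1) * (Cmax + 1)"
    using Cmax_nonneg pi_gt3 by (intro mult_mono) auto
  then show "2 * Cmax \<le> Umax" by (simp add: Umax_def)
  show "8 * pi * \<bar>of_int k\<bar> * Cmax \<le> Umax"
    unfolding Umax_def using Cmax_nonneg abs_freqs_le[OF assms] by (intro mult_mono) auto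
qed

lemma norm_coef_le:
  assumes "k \<in> freqs" shows "norm (coef k n) \<le> Cmax * real n powr (- 1 - \<delta>)"
  using norm_C_le[OF assms] by (simp add: coef_def norm_mult mult_right_mono)

lemma square_times_powr:
  assumes "n \<ge> 1" shows "real n^2 * real n powr (- 1 - \<delta>) = real n powr (1 - \<delta>)"
proof -
  have "real n^2 * real n powr (- 1 - \<delta>) = real n powr 2 * real n powr (- 1 - \<delta>)"
    using assms by simp
  also have "\<dots> = real n powr (2 + (- 1 - \<delta>))"
    by (simp only: powr_add)
  finally show ?thesis by simp
qed

lemma powr_split:
  assumes "m \<ge> 1"
  shows "real m powr (- 1 - \<delta>) = real m powr (- \<delta>) / real m"
    and "real m powr (1 - \<delta>) = real m * real m powr (- \<delta>)"
proof -
  have "real m powr (- \<delta> - 1) = real m powr (- \<delta>) / real m powr 1"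
    by (rule powr_diff)
  moreover have "- \<delta> - 1 = - 1 - \<delta>" by simp
  ultimately show "real m powr (- 1 - \<delta>) = real m powr (- \<delta>) / real m"
    by simp
  have "real m powr (1 + - \<delta>) = real m powr 1 * real m powr (- \<delta>)"
    by (rule powr_add)
  then show "real m powr (1 - \<delta>) = real m * real m powr (- \<delta>)"
    by simp
qed

lemma integral_trig_sum_power4_le:
  assumes "A \<subseteq> {1..M}" "M \<ge> 1" "1 + ln (2 * real M) \<le> \<Lambda>"
    and "\<And>k n. k \<in> freqs \<Longrightarrow> n \<in> A \<Longrightarrow> norm (c k n) \<le> Umax * b"
  shows "integral {0..1} (\<lambda>x. norm (trig_sum c freqs A x)^4) \<le> L4const * \<Lambda> * b^4 * real M^2 / 4"
proof -
  have "integral {0..1} (\<lambda>x. norm (trig_sum c freqs A x)^4)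
      \<le> real (card freqs)^4 * (Umax * b)^4 * real (card (square_quads M))"
    using assms freqs by (intro integral_norm_power4_trig_sum_le)
  also have "\<dots> \<le> real (card freqs)^4 * (Umax * b)^4 * (17 * real M^2 * \<Lambda>)"
  proof (intro mult_left_mono)
    have "real (card (square_quads M)) \<le> 17 * real M^2 * (1 + ln (2 * real M))"
      by (rule card_square_quads_le) fact
    also have "\<dots> \<le> 17 * real M^2 * \<Lambda>"
      using assms by (intro mult_left_mono) auto
    finally show "real (card (square_quads M)) \<le> 17 * real M^2 * \<Lambda>" .
  qed auto
  also have "\<dots> = L4const * \<Lambda> * b^4 * real M^2 / 4"
    by (simp add: L4const_def power_mult_distrib)
  finally show ?thesis .
qed

text \<open>On the block the coefficients have size \<open>a / m\<close> and there are about
  \<open>m^2\<close> quadruples, up to a logarithm. Differentiation multiplies the coefficients by a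
  factor of order \<open>m^2\<close>, hence the fourth moment by \<open>m^8\<close>. An increment at
  most doubles a coefficient, whatever \<open>h\<close> is.\<close>

lemma high_power4_bounds:
  assumes m: "m \<ge> 1" and \<Lambda>: "1 + ln (4 * real m) \<le> \<Lambda>"
  defines "A \<equiv> {m<..2 * m}" and "a \<equiv> real m powr (- \<delta>)"
  shows "integral {0..1} (\<lambda>x. norm (trig_sum coef freqs A x)^4) \<le> L4const * \<Lambda> * a^4 / real m^2"
    and "integral {0..1} (\<lambda>x. norm (trig_sum deriv_coef freqs A x)^4) \<le> L4const * \<Lambda> * a^4 * real m^6"
    and "integral {0..1} (\<lambda>x. norm (trig_sum (diff_coef h) freqs A x)^4) \<le> L4const * \<Lambda> * a^4 / real m^2"
proof -
  have A: "A \<subseteq> {1..2 * m}" by (auto simp: A_def)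
  have \<Lambda>': "1 + ln (2 * real (2 * m)) \<le> \<Lambda>" using \<Lambda> by simp
  have m2: "2 * m \<ge> 1" using m by simp
  have coef: "norm (coef k n) \<le> Cmax * (a / real m)" if "k \<in> freqs" "n \<in> A" for k n
  proof -
    have "norm (coef k n) \<le> Cmax * real n powr (- 1 - \<delta>)" by (rule norm_coef_le) fact
    also have "\<dots> \<le> Cmax * real m powr (- 1 - \<delta>)"
      using that m delta Cmax_nonneg by (intro mult_left_mono powr_mono2') (auto simp: A_def)
    finally show ?thesis using m by (simp add: a_def powr_split)
  qed
  have a: "a \<ge> 0" by (simp add: a_def)
  have eq_div: "L4const * \<Lambda> * (a / real m)^4 * real (2 * m)^2 / 4 = L4const * \<Lambda> * a^4 / real m^2"
    using m by (simp add: field_simps power4_eq_xxxx power2_eq_square)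
  have eq_mult: "L4const * \<Lambda> * (a * real m)^4 * real (2 * m)^2 / 4 = L4const * \<Lambda> * a^4 * real m^6"
    by (simp add: power_mult_distrib mult.assoc flip: power_add)
  have "norm (coef k n) \<le> Umax * (a / real m)" if "k \<in> freqs" "n \<in> A" for k n
  proof -
    have "Cmax * (a / real m) \<le> Umax * (a / real m)"
      using Cmax_bounds_Umax(1)[OF that(1)] Cmax_nonneg a by (intro mult_right_mono) auto
    with coef[OF that] show ?thesis by linarith
  qed
  from integral_trig_sum_power4_le[OF A m2 \<Lambda>' this]
  show "integral {0..1} (\<lambda>x. norm (trig_sum coef freqs A x)^4) \<le> L4const * \<Lambda> * a^4 / real m^2"
    by (simp only: eq_div)
  have "norm (diff_coef h k n) \<le> Umax * (a / real m)" if "k \<in> freqs" "n \<in> A" for k n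
  proof -
    have "norm (diff_coef h k n) \<le> Cmax * (a / real m) * (1 + 1)"
      unfolding norm_mult using coef[OF that] norm_triangle_ineq4[of "echar (of_int k * (real n)^2 * h)" 1] Cmax_nonneg a
      by (intro mult_mono) auto
    also have "\<dots> = 2 * Cmax * (a / real m)" by simp
    also have "\<dots> \<le> Umax * (a / real m)"
      using Cmax_bounds_Umax(1)[OF that(1)] a by (intro mult_right_mono) auto
    finally show ?thesis .
  qed
  from integral_trig_sum_power4_le[OF A m2 \<Lambda>' this]
  show "integral {0..1} (\<lambda>x. norm (trig_sum (diff_coef h) freqs A x)^4) \<le> L4const * \<Lambda> * a^4 / real m^2"
    by (simp only: eq_div)
  have "norm (deriv_coef k n) \<le> Umax * (a * real m)" if "k \<in> freqs" "n \<in> A" for k n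
  proof -
    have "norm (deriv_coef k n) = 2 * pi * \<bar>of_int k\<bar> * real n^2 * norm (coef k n)"
      by (simp add: norm_mult norm_power)
    also have "\<dots> \<le> 2 * pi * \<bar>of_int k\<bar> * real (2 * m)^2 * (Cmax * (a / real m))"
      using that coef[OF that] by (intro mult_mono power_mono) (auto simp: A_def)
    also have "\<dots> = 8 * pi * \<bar>of_int k\<bar> * Cmax * (a * real m)"
      using m by (simp add: power2_eq_square)
    also have "\<dots> \<le> Umax * (a * real m)"
      using Cmax_bounds_Umax(2)[OF that(1)] a by (intro mult_right_mono) auto
    finally show ?thesis .
  qed
  from integral_trig_sum_power4_le[OF A m2 \<Lambda>' this]
  show "integral {0..1} (\<lambda>x. norm (trig_sum deriv_coef freqs A x)^4) \<le> L4const * \<Lambda> * a^4 * real m^6"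
    by (simp only: eq_mult)
qed

text \<open>Differentiated coefficients have size \<open>n powr (1 - \<delta>)\<close>, which is
  nondecreasing because \<open>\<delta> \<le> 1\<close>. All of them are therefore bounded by the
  value at \<open>M\<close>, and the low part needs no dyadic splitting. Increments satisfy the same
  bound times \<open>h\<close>, as a chord is shorter than its arc.\<close>

lemma low_power4_bounds:
  assumes M: "M \<ge> 1" and \<Lambda>: "1 + ln (2 * real M) \<le> \<Lambda>"
  defines "A \<equiv> {1..M}" and "a \<equiv> real M powr (- \<delta>)"
  shows "integral {0..1} (\<lambda>x. norm (trig_sum deriv_coef freqs A x)^4) \<le> L4const * \<Lambda> * a^4 * real M^6"
    and "h \<ge> 0 \<Longrightarrow> integral {0..1} (\<lambda>x. norm (trig_sum (diff_coef h) freqs A x)^4) \<le> L4const * \<Lambda> * a^4 * real M^6 * h^4"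
proof -
  have A: "A \<subseteq> {1..M}" by (simp add: A_def)
  have "ln (2 * real M) \<ge> 0" using M by simp
  then have \<Lambda>0: "\<Lambda> \<ge> 0" using \<Lambda> by simp
  have a: "a \<ge> 0" by (simp add: a_def)
  have coef: "\<bar>of_int k\<bar> * real n^2 * norm (coef k n) \<le> \<bar>of_int k\<bar> * Cmax * (a * real M)" if "k \<in> freqs" "n \<in> A" for k n
  proof -
    have n: "n \<ge> 1" "n \<le> M" using that by (auto simp: A_def)
    have "real n^2 * norm (coef k n) \<le> real n^2 * (Cmax * real n powr (- 1 - \<delta>))"
      using norm_coef_le[OF that(1)] by (intro mult_left_mono) auto
    also have "\<dots> = Cmax * real n powr (1 - \<delta>)"
      using square_times_powr[OF n(1)] by simp
    also have "\<dots> \<le> Cmax * real M powr (1 - \<delta>)"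
      using n delta Cmax_nonneg by (intro mult_left_mono powr_mono2) auto
    finally have "real n^2 * norm (coef k n) \<le> Cmax * (a * real M)"
      using M by (simp add: powr_split a_def ac_simps)
    then show ?thesis by (simp add: mult.assoc mult_left_mono)
  qed
  have bound: "2 * pi * (\<bar>of_int k\<bar> * Cmax * (a * real M)) \<le> Umax * (a * real M)" if "k \<in> freqs" for k
  proof -
    have "2 * pi * \<bar>of_int k\<bar> * Cmax \<le> 8 * pi * \<bar>of_int k\<bar> * Cmax"
      using Cmax_nonneg by (intro mult_right_mono) auto
    also have "\<dots> \<le> Umax" by (rule Cmax_bounds_Umax(2)[OF that])
    finally have "2 * pi * \<bar>of_int k\<bar> * Cmax * (a * real M) \<le> Umax * (a * real M)"
      using a by (intro mult_right_mono) auto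
    then show ?thesis by (simp add: mult.assoc)
  qed
  have "norm (deriv_coef k n) \<le> Umax * (a * real M)" if "k \<in> freqs" "n \<in> A" for k n
  proof -
    have "norm (deriv_coef k n) = 2 * pi * (\<bar>of_int k\<bar> * real n^2 * norm (coef k n))"
      by (simp add: norm_mult norm_power)
    also have "\<dots> \<le> 2 * pi * (\<bar>of_int k\<bar> * Cmax * (a * real M))"
      using coef[OF that] by (intro mult_left_mono) auto
    also have "\<dots> \<le> Umax * (a * real M)" by (rule bound[OF that(1)])
    finally show ?thesis .
  qed
  from integral_trig_sum_power4_le[OF A M \<Lambda> this]
  have "integral {0..1} (\<lambda>x. norm (trig_sum deriv_coef freqs A x)^4) \<le> L4const * \<Lambda> * a^4 * real M^6 / 4"
    by (simp add: power_mult_distrib mult.assoc flip: power_add)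
  moreover have "L4const * \<Lambda> * a^4 * real M^6 \<ge> 0"
    by (intro mult_nonneg_nonneg L4const_nonneg \<Lambda>0) auto
  ultimately
  show "integral {0..1} (\<lambda>x. norm (trig_sum deriv_coef freqs A x)^4) \<le> L4const * \<Lambda> * a^4 * real M^6"
    by linarith
  assume h: "h \<ge> 0"
  have "real M^6 = real M^4 * real M^2" by (simp flip: power_add)
  then have "(a * real M * h)^4 * real M^2 = a^4 * real M^6 * h^4" by (simp add: power_mult_distrib)
  then have eq: "L4const * \<Lambda> * (a * real M * h)^4 * real M^2 / 4 = L4const * \<Lambda> * a^4 * real M^6 * h^4 / 4"
    by (simp add: mult.assoc)
  have "norm (diff_coef h k n) \<le> Umax * (a * real M * h)" if "k \<in> freqs" "n \<in> A" for k n
  proof -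
    have "norm (diff_coef h k n) \<le> norm (coef k n) * (2 * pi * \<bar>of_int k * (real n)^2 * h\<bar>)"
      unfolding norm_mult by (intro mult_left_mono norm_echar_minus_1_le) auto
    also have "\<dots> = 2 * pi * (\<bar>of_int k\<bar> * real n^2 * norm (coef k n)) * h"
      using h by (simp add: abs_mult)
    also have "\<dots> \<le> 2 * pi * (\<bar>of_int k\<bar> * Cmax * (a * real M)) * h"
      using coef[OF that] h by (intro mult_right_mono mult_left_mono) auto
    also have "\<dots> \<le> Umax * (a * real M) * h" using bound[OF that(1)] h by (intro mult_right_mono)
    finally show ?thesis by (simp add: mult.assoc)
  qed
  from integral_trig_sum_power4_le[OF A M \<Lambda> this]
  have "integral {0..1} (\<lambda>x. norm (trig_sum (diff_coef h) freqs A x)^4) \<le> L4const * \<Lambda> * a^4 * real M^6 * h^4 / 4"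
    by (simp only: eq)
  moreover have "L4const * \<Lambda> * a^4 * real M^6 * h^4 \<ge> 0"
    by (intro mult_nonneg_nonneg L4const_nonneg \<Lambda>0) auto
  ultimately show "integral {0..1} (\<lambda>x. norm (trig_sum (diff_coef h) freqs A x)^4) \<le> L4const * \<Lambda> * a^4 * real M^6 * h^4"
    by linarith
qed

end

section \<open>The upper bound\<close>

context trig_series
begin

text \<open>\<open>M\<close> is the integer part of the square root of \<open>X\<close>, where
  frequencies reach the reciprocal side of the boxes, and \<open>J\<close> is the number of dyadic
  blocks after which the tail is of order \<open>1 / X\<close>. Both \<open>J\<close> and the
  largest logarithm that occurs are \<open>O(1 + ln X)\<close>.\<close>

lemma dyadic_parameters:
  assumes "X \<ge> 1"
  obtains M J :: nat where "M \<ge> 1" "M^2 \<le> X" "X \<le> 4 * M^2" "J \<ge> 1" "real X \<le> (2^J) powr \<delta>"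
    "real J \<le> (2 / \<delta> + 4) * (1 + ln (real X))" "1 + ln (2 * (2^J * real M)) \<le> (2 / \<delta> + 4) * (1 + ln (real X))"
proof -
  define M where "M = nat \<lfloor>sqrt (real X)\<rfloor>"
  \<comment> \<open>The added 1 ensures \<open>J \<ge> 1\<close> even for \<open>X = 1\<close>; the
    lower bound also needs it to fit \<open>{1..2 * M}\<close> into
    \<open>{1..2^J * M}\<close>.\<close>
  define J where "J = nat \<lceil>log 2 (real X) / \<delta>\<rceil> + 1"
  have sX: "sqrt (real X) \<ge> 1" using assms by simp
  have lnX: "ln (real X) \<ge> 0" using assms by simp
  have M: "real M \<le> sqrt (real X)" "sqrt (real X) \<le> real M + 1" "M \<ge> 1"
    using sX unfolding M_def by linarith+
  have "real M^2 \<le> sqrt (real X)^2" using M by (intro power_mono) auto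
  then have 1: "M^2 \<le> X" by (simp flip: of_nat_power)
  have "sqrt (real X)^2 \<le> (2 * real M)^2" using M by (intro power_mono) auto
  then have "real X \<le> real (4 * M^2)" by (simp add: power_mult_distrib)
  then have 2: "X \<le> 4 * M^2" by (simp only: of_nat_le_iff)
  have l2: "ln 2 \<ge> (1 / 2 :: real)" "ln 2 \<le> (1 :: real)"
    using ln2_ge_two_thirds ln_2_less_1 by linarith+
  have lg0: "log 2 (real X) \<ge> 0" using assms by simp
  have J: "log 2 (real X) / \<delta> \<le> real J" "real J \<le> log 2 (real X) / \<delta> + 2"
    using lg0 delta unfolding J_def by (simp_all add: of_nat_nat) linarith+
  have "real X = 2 powr log 2 (real X)" using assms by simp
  also have "\<dots> \<le> 2 powr (real J * \<delta>)"
    using J delta by (intro powr_mono) (auto simp: field_simps)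
  also have "\<dots> = (2^J) powr \<delta>" by (simp add: powr_powr[symmetric] powr_realpow)
  finally have 3: "real X \<le> (2^J) powr \<delta>" .
  have "log 2 (real X) = ln (real X) / ln 2" by (simp add: log_def)
  also have "\<dots> \<le> ln (real X) / (1 / 2)" using lnX l2 by (intro divide_left_mono) auto
  finally have "log 2 (real X) / \<delta> \<le> 2 * ln (real X) / \<delta>"
    using delta by (intro divide_right_mono) auto
  with J have "real J \<le> 2 / \<delta> * ln (real X) + 2" by simp
  also have "\<dots> \<le> 2 / \<delta> * (1 + ln (real X)) + 2 * (1 + ln (real X))"
    using delta lnX by (intro add_mono mult_left_mono) auto
  finally have Jle: "real J \<le> 2 / \<delta> * (1 + ln (real X)) + 2 * (1 + ln (real X))" .
  have 4: "real J \<le> (2 / \<delta> + 4) * (1 + ln (real X))"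
    using Jle lnX by (simp add: distrib_right)
  have "ln (2 * (2^J * real M)) = ln 2 + real J * ln 2 + ln (real M)"
    using M by (simp add: ln_mult ln_realpow)
  moreover have "real J * ln 2 \<le> real J * 1" using l2 by (intro mult_left_mono) auto
  moreover have "ln (real M) \<le> ln (real X)"
  proof -
    have "M \<le> M^2" using M by (simp add: power2_eq_square)
    then show ?thesis using M 1 by simp
  qed
  ultimately have "1 + ln (2 * (2^J * real M)) \<le> 2 + real J + ln (real X)"
    using l2 by linarith
  also have "\<dots> \<le> (2 / \<delta> + 4) * (1 + ln (real X))"
    using Jle lnX by (simp add: distrib_right)
  finally show ?thesis using that[of M J] M 1 2 3 4 by (auto simp: J_def)
qed

text \<open>The first quantity is the scale of the oscillations summed over \<open>X\<close> cells,
  the second that of a single increment. Both follow from \<open>M^2 \<le> X\<close>, since the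
  exponent of \<open>X\<close> is positive in one case and negative in the other.\<close>

lemma powr_scale:
  assumes "M \<ge> 1" "M^2 \<le> X"
  shows "real M powr (- \<delta>) * real M * sqrt (real M) \<le> real X powr (3 / 4 - \<delta> / 2)"
    and "real X powr (- (1 / 4 + \<delta> / 2)) \<le> real M powr (- \<delta>) / sqrt (real M)"
proof -
  have sq: "(real M powr 2) = real (M^2)" using assms by simp
  have MX: "real (M^2) \<le> real X" using assms by (simp only: of_nat_le_iff)
  have "real M powr (- \<delta>) * real M * sqrt (real M) = real M powr (- \<delta>) * real M powr 1 * real M powr (1 / 2)"
    using assms by (simp add: powr_half_sqrt)
  also have "\<dots> = real M powr (- \<delta> + 1 + 1 / 2)"
    by (simp only: powr_add)
  also have "\<dots> = real M powr (2 * (3 / 4 - \<delta> / 2))"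
    by (simp add: algebra_simps)
  also have "\<dots> = real (M^2) powr (3 / 4 - \<delta> / 2)"
    by (simp only: sq powr_powr[symmetric])
  also have "\<dots> \<le> real X powr (3 / 4 - \<delta> / 2)"
    using MX delta by (intro powr_mono2) auto
  finally show "real M powr (- \<delta>) * real M * sqrt (real M) \<le> real X powr (3 / 4 - \<delta> / 2)" .
  have "real X powr (- (1 / 4 + \<delta> / 2)) \<le> real (M^2) powr (- (1 / 4 + \<delta> / 2))"
    using MX delta assms by (intro powr_mono2') auto
  also have "\<dots> = real M powr (2 * (- (1 / 4 + \<delta> / 2)))"
    by (simp only: sq powr_powr[symmetric])
  also have "\<dots> = real M powr (- \<delta> - 1 / 2)"
    by (simp add: algebra_simps)
  also have "\<dots> = real M powr (- \<delta>) / real M powr (1 / 2)"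
    by (rule powr_diff)
  also have "\<dots> = real M powr (- \<delta>) / sqrt (real M)"
    by (simp add: powr_half_sqrt)
  finally show "real X powr (- (1 / 4 + \<delta> / 2)) \<le> real M powr (- \<delta>) / sqrt (real M)" .
qed

lemma tail_le:
  assumes "M \<ge> 1" "real X \<le> (2^J) powr \<delta>" "X \<ge> 1"
  shows "norm (of_real (G \<delta> g x) - trig_sum coef freqs {1..2^J * M} x) \<le> Cmax / \<delta> / real X"
proof -
  have "real (2^J * M) powr (- \<delta>) \<le> real (2^J) powr (- \<delta>)"
    using assms delta by (intro powr_mono2') auto
  also have "\<dots> = 1 / ((2^J) powr \<delta>)" by (simp add: powr_minus_divide)
  also have "\<dots> \<le> 1 / real X" using assms by (intro divide_left_mono) auto
  finally have "Cmax / \<delta> * real (2^J * M) powr (- \<delta>) \<le> Cmax / \<delta> * (1 / real X)"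
    using Cmax_nonneg delta by (intro mult_left_mono) auto
  with norm_G_diff_trig_sum_le[of "2^J * M" x] assms show ?thesis
    by (simp add: Suc_le_eq)
qed

text \<open>The low part contributes \<open>1 + L4const\<close> and each dyadic block
  \<open>8 + 16 * L4const\<close>, in units of \<open>b\<close> up to logarithms; the tail adds
  \<open>2 * Cmax / \<delta>\<close>. The outer 2 and 1 come from the count
  \<open>2 * X * r i + 1\<close> per cell.\<close>

definition upper_const :: real where
  "upper_const = 2 * (9 + 17 * L4const + 2 * Cmax / \<delta>) + 1"

lemma box_count_upper:
  assumes M: "M \<ge> 1" "M^2 \<le> X" "X \<le> 4 * M^2" and J: "J \<ge> 1" "real X \<le> (2^J) powr \<delta>"
    and \<Lambda>: "1 + ln (2 * (2^J * real M)) \<le> \<Lambda>"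
  defines "b \<equiv> real M powr (- \<delta>) * real M * sqrt (real M)"
  shows "real (box_count X (graph_G \<delta> g)) \<le> upper_const * (real X * b * \<Lambda> * real J)"
proof -
  define a where "a = real M powr (- \<delta>)"
  \<comment> \<open>The typical size of the block starting at \<open>M\<close>: about
    \<open>M\<close> terms of size \<open>a / M\<close> with square-root cancellation. It balances
    the two terms of the high-frequency bound, since \<open>X * \<tau> \<le> 4 * b\<close> and
    \<open>a^4 / \<tau>^3 = b\<close>.\<close>
  define \<tau> where "\<tau> = a / sqrt (real M)"
  define D where "D = L4const * \<Lambda>"
  have "1 \<le> M^2" using M(1) by simp
  then have X: "X \<ge> 1" using M(2) by linarith
  have a0: "a > 0" using M by (simp add: a_def)
  have s: "sqrt (real M) * sqrt (real M) = real M" "sqrt (real M) > 0" using M by auto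
  have b0: "b > 0" using M by (simp add: b_def)
  have b_eq: "b = a * real M * sqrt (real M)" by (simp add: a_def b_def)
  have \<tau>0: "\<tau> > 0" using a0 s by (simp add: \<tau>_def)
  have b4: "b^4 = a^4 * real M^6"
  proof -
    have "sqrt (real M)^4 = real M^2" using s(1) by (simp add: power4_eq_xxxx power2_eq_square)
    moreover have "real M^6 = real M^4 * real M^2" by (simp flip: power_add)
    ultimately show ?thesis by (simp add: b_eq power_mult_distrib)
  qed
  have a\<tau>: "a^4 / \<tau>^3 = b"
    using s a0 by (simp add: \<tau>_def b_eq power_divide power4_eq_xxxx power3_eq_cube)
  have X\<tau>: "real X * \<tau> \<le> 4 * b"
  proof -
    have "real X \<le> real (4 * M^2)" using M by (simp only: of_nat_le_iff)
    then have "real X * \<tau> \<le> 4 * real M^2 * \<tau>" using \<tau>0 by (intro mult_right_mono) auto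
    also have "\<dots> = 4 * b"
      using s by (simp add: \<tau>_def b_eq power2_eq_square field_simps)
    finally show ?thesis .
  qed
  have b1: "b \<ge> 1"
  proof -
    have "1 \<le> real M powr (1 - \<delta>)" using M delta by (intro ge_one_powr_ge_zero) auto
    moreover have "1 \<le> sqrt (real M)" using M by simp
    ultimately have "1 * 1 \<le> real M powr (1 - \<delta>) * sqrt (real M)" by (intro mult_mono) auto
    then show ?thesis using M by (simp add: b_def powr_split ac_simps)
  qed
  have "1 * 1 \<le> 2^J * real M" using M by (intro mult_mono) auto
  then have "ln (2 * (2^J * real M)) \<ge> 0" by (intro ln_ge_zero) simp
  then have \<Lambda>1: "\<Lambda> \<ge> 1" using \<Lambda> by simp
  have D0: "D \<ge> 0" using \<Lambda>1 L4const_nonneg by (simp add: D_def)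
  have ln_high: "1 + ln (4 * real (2^j * M)) \<le> \<Lambda>" if "j < J" for j
  proof -
    have "(2::real)^(Suc j) \<le> 2^J" using that by (intro power_increasing) auto
    then have "4 * real (2^j * M) \<le> 2 * (2^J * real M)"
      using M by simp
    then have "ln (4 * real (2^j * M)) \<le> ln (2 * (2^J * real M))"
      using M by (intro ln_mono) auto
    then show ?thesis using \<Lambda> by linarith
  qed
  have ln_low: "1 + ln (2 * real M) \<le> \<Lambda>"
  proof -
    have "1 * real M \<le> 2^J * real M" by (intro mult_right_mono) auto
    then have "ln (2 * real M) \<le> ln (2 * (2^J * real M))" using M by (intro ln_mono) auto
    then show ?thesis using \<Lambda> by linarith
  qed
  have cont: "continuous_on UNIV (trig_sum c S A)" for c S A
    using continuous_on_trig_sum[OF continuous_on_id] .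
  define osc where "osc u R \<longleftrightarrow> (\<forall>i<X. 0 \<le> R i \<and> (\<forall>y\<in>cell X i. norm (u y - u (real i / real X)) \<le> R i))"
    for u :: "real \<Rightarrow> complex" and R :: "nat \<Rightarrow> real"
  \<comment> \<open>The threshold is \<open>b\<close>, the typical size of the derivative of the low
    part: its fourth moment is at most \<open>D * b^4\<close>.\<close>
  have "\<exists>R. osc (trig_sum coef freqs {1..M}) R \<and> (\<Sum>i<X. R i) \<le> b + L4const * \<Lambda> * a^4 * real M^6 / b^3"
    unfolding osc_def a_def
    by (rule low_oscillation_sum[OF trig_sum_has_vector_derivative cont low_power4_bounds(1)[OF M(1) ln_low] b0 X])
  then obtain R0 where R0: "osc (trig_sum coef freqs {1..M}) R0"
    "(\<Sum>i<X. R0 i) \<le> b + L4const * \<Lambda> * a^4 * real M^6 / b^3" by blast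
  have "L4const * \<Lambda> * a^4 * real M^6 / b^3 = D * b"
    using b0 by (simp add: D_def b4[symmetric] mult.assoc) (simp add: power4_eq_xxxx power3_eq_cube)
  with R0(2) have R0': "(\<Sum>i<X. R0 i) \<le> b + D * b" by simp
  have "\<exists>R. osc (trig_sum coef freqs {2^j * M<..2 * (2^j * M)}) R \<and> (\<Sum>i<X. R i) \<le> 8 * b + 16 * D * b" if j: "j < J" for j
  proof -
    define m where "m = 2^j * M"
    define aj where "aj = real m powr (- \<delta>)"
    have m: "m \<ge> 1" "M \<le> m" using M by (auto simp: m_def)
    have aj: "0 \<le> aj" "aj \<le> a" using m M delta by (auto simp: aj_def a_def intro!: powr_mono2')
    \<comment> \<open>The weight \<open>m^2\<close> is the order of the frequencies in the block; it
      brings \<open>w * E\<close> and \<open>E' / w^3\<close> to the same size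
      \<open>D * aj^4\<close>.\<close>
    have w: "real m^2 > 0" using m by simp
    note bnd = high_power4_bounds[OF m(1) ln_high[OF j, folded m_def]]
    have "\<exists>R. osc (trig_sum coef freqs {m<..2 * m}) R \<and> (\<Sum>i<X. R i)
        \<le> 2 * (real X * \<tau> + ((real X + 3 * real m^2) * (L4const * \<Lambda> * aj^4 / real m^2)
             + L4const * \<Lambda> * aj^4 * real m^6 / (real m^2)^3) / \<tau>^3)"
      unfolding osc_def aj_def
      by (rule high_oscillation_sum[OF trig_sum_has_vector_derivative cont cont bnd(1,2) \<tau>0 w X])
    then obtain R where R: "osc (trig_sum coef freqs {m<..2 * m}) R"
      "(\<Sum>i<X. R i) \<le> 2 * (real X * \<tau> + ((real X + 3 * real m^2) * (L4const * \<Lambda> * aj^4 / real m^2)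
             + L4const * \<Lambda> * aj^4 * real m^6 / (real m^2)^3) / \<tau>^3)" by blast
    have "real X \<le> 4 * real m^2"
    proof -
      have "real X \<le> real (4 * M^2)" using M by (simp only: of_nat_le_iff)
      also have "\<dots> \<le> 4 * real m^2" using m by (simp add: power_mono)
      finally show ?thesis .
    qed
    then have "(real X + 3 * real m^2) * (D * aj^4 / real m^2) \<le> 7 * real m^2 * (D * aj^4 / real m^2)"
      using D0 aj by (intro mult_right_mono) auto
    also have "\<dots> = 7 * D * aj^4" using m by simp
    finally have "(real X + 3 * real m^2) * (D * aj^4 / real m^2) + D * aj^4 * real m^6 / (real m^2)^3 \<le> 8 * D * aj^4"
      using m by (simp flip: power_mult)
    \<comment> \<open>The decay of \<open>aj\<close> in \<open>j\<close> is given away: bounding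
      every block like the first costs a factor \<open>J\<close>, a logarithm.\<close>
    also have "\<dots> \<le> 8 * D * a^4" using aj D0 by (intro mult_left_mono power_mono) auto
    finally have "((real X + 3 * real m^2) * (D * aj^4 / real m^2) + D * aj^4 * real m^6 / (real m^2)^3) / \<tau>^3 \<le> 8 * D * a^4 / \<tau>^3"
      using \<tau>0 by (intro divide_right_mono) auto
    also have "\<dots> = 8 * D * (a^4 / \<tau>^3)" by simp
    also have "\<dots> = 8 * D * b" by (simp only: a\<tau>)
    finally have Z: "((real X + 3 * real m^2) * (D * aj^4 / real m^2) + D * aj^4 * real m^6 / (real m^2)^3) / \<tau>^3 \<le> 8 * D * b" .
    have "(\<Sum>i<X. R i) \<le> 2 * (4 * b + 8 * D * b)"
      by (rule order_trans[OF R(2)[folded D_def]], intro mult_left_mono add_mono X\<tau> Z) auto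
    with R(1) show ?thesis unfolding m_def by (intro exI[of _ R]) simp
  qed
  then have "\<forall>j\<in>{..<J}. \<exists>R. osc (trig_sum coef freqs {2^j * M<..2 * (2^j * M)}) R \<and> (\<Sum>i<X. R i) \<le> 8 * b + 16 * D * b"
    by blast
  then obtain R where R: "\<And>j. j < J \<Longrightarrow> osc (trig_sum coef freqs {2^j * M<..2 * (2^j * M)}) (R j)"
    "\<And>j. j < J \<Longrightarrow> (\<Sum>i<X. R j i) \<le> 8 * b + 16 * D * b"
    unfolding bchoice_iff by blast
  define t where "t = Cmax / \<delta> / real X"
  have t0: "t \<ge> 0" using Cmax_nonneg delta by (simp add: t_def)
  define r where "r i = R0 i + (\<Sum>j<J. R j i) + 2 * t" for i
  have r0: "0 \<le> r i" if "i < X" for i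
    using that R0(1) R(1) t0 unfolding r_def osc_def by (intro add_nonneg_nonneg sum_nonneg) auto
  have rosc: "\<bar>G \<delta> g y - G \<delta> g (real i / real X)\<bar> \<le> r i" if i: "i < X" and y: "y \<in> {real i / real X..real (Suc i) / real X}" for i y
  proof -
    have y': "y \<in> cell X i" using y by (simp add: cell_def)
    define l where "l = real i / real X"
    define T where "T = trig_sum coef freqs {1..2^J * M}"
    have diff_eq: "T y - T l = (trig_sum coef freqs {1..M} y - trig_sum coef freqs {1..M} l)
       + (\<Sum>j<J. trig_sum coef freqs {2^j * M<..2 * (2^j * M)} y - trig_sum coef freqs {2^j * M<..2 * (2^j * M)} l)"
      unfolding T_def trig_sum_dyadic sum_subtractf by simp
    have T: "norm (T y - T l) \<le> R0 i + (\<Sum>j<J. R j i)"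
      unfolding diff_eq using i y' R0(1) R(1) unfolding osc_def l_def
      by (intro norm_triangle_mono sum_norm_le) auto
    have t: "norm (of_real (G \<delta> g x) - T x) \<le> t" for x
      unfolding T_def t_def by (rule tail_le[OF M(1) J(2) X])
    have split: "complex_of_real (G \<delta> g y - G \<delta> g l)
        = (of_real (G \<delta> g y) - T y) + (T y - T l) - (of_real (G \<delta> g l) - T l)"
      by simp
    have tri: "norm (p + q - s) \<le> norm p + norm q + norm s" for p q s :: complex
      using norm_triangle_ineq4[of "p + q" s] norm_triangle_ineq[of p q] by linarith
    have "norm (complex_of_real (G \<delta> g y - G \<delta> g l)) \<le> t + (R0 i + (\<Sum>j<J. R j i)) + t"
      unfolding split by (rule order_trans[OF tri]) (intro add_mono t T)
    then show ?thesis unfolding norm_of_real l_def r_def by simp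
  qed
  obtain \<B> where \<B>: "finite \<B>" "\<forall>B\<in>\<B>. is_box (1 / real X) B" "{(x, G \<delta> g x) | x. x \<in> {0..1}} \<subseteq> \<Union>\<B>"
    "real (card \<B>) \<le> (\<Sum>i<X. 2 * real X * r i + 1)"
    using graph_box_cover[where f = "G \<delta> g" and r = r, OF X r0 rosc] by blast
  have bc: "real (box_count X (graph_G \<delta> g)) \<le> real (card \<B>)"
    unfolding graph_G_def using box_count_le[OF \<B>(1-3)] by simp
  have lJ: "1 \<le> \<Lambda> * real J" using mult_mono[of 1 \<Lambda> 1 "real J"] \<Lambda>1 J(1) by simp
  have blJ: "1 \<le> b * (\<Lambda> * real J)" using mult_mono[of 1 b 1 "\<Lambda> * real J"] b1 lJ by simp
  have "(\<Sum>i<X. r i) = (\<Sum>i<X. R0 i) + (\<Sum>j<J. \<Sum>i<X. R j i) + 2 * (Cmax / \<delta>)"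
  proof -
    have "(\<Sum>i<X. \<Sum>j<J. R j i) = (\<Sum>j<J. \<Sum>i<X. R j i)" by (rule sum.swap)
    then show ?thesis using X by (simp add: r_def sum.distrib t_def)
  qed
  also have "\<dots> \<le> (b + D * b) + real J * (8 * b + 16 * D * b) + 2 * (Cmax / \<delta>)"
  proof (intro add_mono R0' order_refl)
    show "(\<Sum>j<J. \<Sum>i<X. R j i) \<le> real J * (8 * b + 16 * D * b)"
      using sum_bounded_above[of "{..<J}" "\<lambda>j. \<Sum>i<X. R j i" "8 * b + 16 * D * b"] R(2) by simp
  qed
  also have "\<dots> \<le> (9 + 17 * L4const + 2 * Cmax / \<delta>) * (b * (\<Lambda> * real J))"
  proof -
    have J1: "1 \<le> real J" using J by simp
    have 1: "b \<le> b * (\<Lambda> * real J)" using b0 lJ by simp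
    have 2: "D * b \<le> L4const * (b * (\<Lambda> * real J))"
    proof -
      have "D * b * 1 \<le> D * b * real J" using D0 b0 J1 by (intro mult_left_mono) auto
      then show ?thesis by (simp add: D_def ac_simps)
    qed
    have 3: "real J * b \<le> b * (\<Lambda> * real J)"
    proof -
      have "1 * (real J * b) \<le> \<Lambda> * (real J * b)" using b0 \<Lambda>1 by (intro mult_right_mono) auto
      then show ?thesis by (simp add: ac_simps)
    qed
    have 4: "real J * (D * b) = L4const * (b * (\<Lambda> * real J))" by (simp add: D_def)
    have 5: "Cmax / \<delta> * 1 \<le> Cmax / \<delta> * (b * (\<Lambda> * real J))"
      using Cmax_nonneg delta blJ by (intro mult_left_mono) auto
    have "(b + D * b) + real J * (8 * b + 16 * D * b) + 2 * (Cmax / \<delta>)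
        = b + D * b + 8 * (real J * b) + 16 * (real J * (D * b)) + 2 * (Cmax / \<delta> * 1)"
      by (simp add: algebra_simps)
    also have "\<dots> \<le> b * (\<Lambda> * real J) + L4const * (b * (\<Lambda> * real J)) + 8 * (b * (\<Lambda> * real J))
       + 16 * (L4const * (b * (\<Lambda> * real J))) + 2 * (Cmax / \<delta> * (b * (\<Lambda> * real J)))"
      using 1 2 3 4 5 by linarith
    also have "\<dots> = (9 + 17 * L4const + 2 * Cmax / \<delta>) * (b * (\<Lambda> * real J))"
      by (simp add: algebra_simps)
    finally show ?thesis .
  qed
  finally have rsum: "(\<Sum>i<X. r i) \<le> (9 + 17 * L4const + 2 * Cmax / \<delta>) * (b * (\<Lambda> * real J))" .
  have "(\<Sum>i<X. 2 * real X * r i + 1) = 2 * real X * (\<Sum>i<X. r i) + real X * 1"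
    by (simp add: sum.distrib sum_distrib_left)
  also have "\<dots> \<le> 2 * real X * ((9 + 17 * L4const + 2 * Cmax / \<delta>) * (b * (\<Lambda> * real J))) + real X * (b * (\<Lambda> * real J))"
    by (intro add_mono mult_left_mono rsum blJ) auto
  also have "\<dots> = upper_const * (real X * b * \<Lambda> * real J)"
    by (simp add: upper_const_def algebra_simps)
  finally show ?thesis using bc \<B>(4) by linarith
qed

lemma box_count_upper_powr:
  "\<exists>c>0. \<forall>X\<ge>1. real (box_count X (graph_G \<delta> g)) \<le> c * real X powr (7 / 4 - \<delta> / 2) * (1 + ln (real X))^2"
proof (intro exI conjI allI impI)
  define q where "q = 2 / \<delta> + 4"
  have q: "q > 0" using delta by (simp add: q_def add_pos_pos)
  have uc: "upper_const > 0"
    using L4const_nonneg Cmax_nonneg delta unfolding upper_const_def by (intro add_nonneg_pos mult_nonneg_nonneg add_nonneg_nonneg) auto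
  show "upper_const * q^2 > 0" using uc q by simp
  fix X :: nat assume X: "X \<ge> 1"
  define L where "L = 1 + ln (real X)"
  have L: "L \<ge> 0" using X by (simp add: L_def)
  obtain M J where P: "M \<ge> 1" "M^2 \<le> X" "X \<le> 4 * M^2" "J \<ge> 1" "real X \<le> (2^J) powr \<delta>"
    "real J \<le> q * L" "1 + ln (2 * (2^J * real M)) \<le> q * L"
    unfolding q_def L_def by (rule dyadic_parameters[OF X])
  have "real (box_count X (graph_G \<delta> g))
      \<le> upper_const * (real X * (real M powr (- \<delta>) * real M * sqrt (real M)) * (q * L) * real J)"
    by (rule box_count_upper[OF P(1-5,7)])
  also have "\<dots> \<le> upper_const * (real X * real X powr (3 / 4 - \<delta> / 2) * (q * L) * (q * L))"
    using uc q L P by (intro mult_left_mono mult_mono powr_scale) auto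
  also have "real X * real X powr (3 / 4 - \<delta> / 2) = real X powr (7 / 4 - \<delta> / 2)"
  proof -
    have "real X powr 1 * real X powr (3 / 4 - \<delta> / 2) = real X powr (1 + (3 / 4 - \<delta> / 2))"
      by (simp only: powr_add)
    then show ?thesis by simp
  qed
  finally show "real (box_count X (graph_G \<delta> g)) \<le> upper_const * q^2 * real X powr (7 / 4 - \<delta> / 2) * (1 + ln (real X))^2"
    by (simp add: L_def power2_eq_square ac_simps)
qed

end

section \<open>The lower bound\<close>

lemma has_integral_trig_sum_pairing:
  assumes "finite S" "finite A" "finite B"
  shows "((\<lambda>x. trig_sum c S A x * cnj (trig_sum (\<lambda>_ _. 1) {k0} B x)) has_integral
     (\<Sum>k\<in>S. \<Sum>j\<in>A. \<Sum>n\<in>B. c k j * (if k * int j^2 = k0 * int n^2 then 1 else 0))) {0..1}"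
proof -
  have eq: "trig_sum c S A x * cnj (trig_sum (\<lambda>_ _. 1) {k0} B x)
      = (\<Sum>k\<in>S. \<Sum>j\<in>A. \<Sum>n\<in>B. c k j * echar (of_int (k * int j^2 - k0 * int n^2) * x))" for x
  proof -
    have term_eq: "c k j * echar (of_int k * (real j)^2 * x) * echar (- (of_int k0 * (real n)^2 * x))
        = c k j * echar (of_int (k * int j^2 - k0 * int n^2) * x)" for k j n
      by (simp add: mult.assoc echar_add[symmetric] left_diff_distrib)
    have "cnj (trig_sum (\<lambda>_ _. 1) {k0} B x) = (\<Sum>n\<in>B. echar (- (of_int k0 * (real n)^2 * x)))"
      by (simp add: trig_sum_def cnj_echar)
    then have "trig_sum c S A x * cnj (trig_sum (\<lambda>_ _. 1) {k0} B x)
        = (\<Sum>k\<in>S. \<Sum>j\<in>A. c k j * echar (of_int k * (real j)^2 * x) * (\<Sum>n\<in>B. echar (- (of_int k0 * (real n)^2 * x))))"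
      by (simp only: trig_sum_def[of c] sum_distrib_right)
    then show ?thesis
      by (simp only: sum_distrib_left term_eq)
  qed
  have "((\<lambda>x. \<Sum>k\<in>S. \<Sum>j\<in>A. \<Sum>n\<in>B. c k j * echar (of_int (k * int j^2 - k0 * int n^2) * x)) has_integral
     (\<Sum>k\<in>S. \<Sum>j\<in>A. \<Sum>n\<in>B. c k j * (if k * int j^2 - k0 * int n^2 = 0 then 1 else 0))) {0..1}"
    by (intro has_integral_sum has_integral_mult_right has_integral_echar assms)
  then show ?thesis by (simp add: eq)
qed

text \<open>Where \<open>y > \<tau>\<close>, the product is at most
  \<open>x * y^3 / \<tau>^2\<close>, hence at most the larger fourth power over
  \<open>\<tau>^2\<close>. Integrated, this turns a lower bound for a pairing and upper bounds for
  fourth moments into a lower bound for a first moment.\<close>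

lemma mult_le_truncated:
  fixes x y \<tau> :: real
  assumes "x \<ge> 0" "y \<ge> 0" "\<tau> > 0"
  shows "x * y \<le> \<tau> * x + (x^4 + y^4) / \<tau>^2"
proof (cases "y \<le> \<tau>")
  case True
  then have "x * y \<le> x * \<tau>" using assms by (intro mult_left_mono)
  then have "x * y \<le> \<tau> * x" by (simp only: mult.commute)
  moreover have "(x^4 + y^4) / \<tau>^2 \<ge> 0" using assms by simp
  ultimately show ?thesis by linarith
next
  case False
  have "x * y^3 \<le> x^4 + y^4"
  proof (cases "x \<le> y")
    case True
    then have "x * y^3 \<le> y * y^3" using assms by (intro mult_right_mono) auto
    also have "\<dots> = y^4" by (simp add: power4_eq_xxxx power3_eq_cube)
    also have "\<dots> \<le> x^4 + y^4" by simp
    finally show ?thesis .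
  next
    case False
    then have "x * y^3 \<le> x * x^3" using assms by (intro mult_left_mono power_mono) auto
    also have "\<dots> = x^4" by (simp add: power4_eq_xxxx power3_eq_cube)
    also have "\<dots> \<le> x^4 + y^4" using assms by simp
    finally show ?thesis .
  qed
  moreover have "x * y * \<tau>^2 \<le> x * y * y^2"
    using assms False by (intro mult_left_mono power_mono) auto
  ultimately have "x * y * \<tau>^2 \<le> x^4 + y^4" by (simp add: power2_eq_square power3_eq_cube mult.assoc)
  then have "x * y \<le> (x^4 + y^4) / \<tau>^2" using assms by (simp add: field_simps)
  moreover have "\<tau> * x \<ge> 0" using assms by simp
  ultimately show ?thesis by linarith
qed

lemma card_nat_between_ge:
  assumes "0 \<le> \<alpha>" shows "real (card {t::nat. \<alpha> \<le> real t \<and> real t \<le> \<beta>}) \<ge> \<beta> - \<alpha> - 1"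
proof -
  have fin: "finite {t::nat. \<alpha> \<le> real t \<and> real t \<le> \<beta>}"
  proof (rule finite_subset)
    show "{t::nat. \<alpha> \<le> real t \<and> real t \<le> \<beta>} \<subseteq> {..nat \<lceil>\<beta>\<rceil>}" by auto linarith
  qed auto
  have "{nat \<lceil>\<alpha>\<rceil>..<nat (\<lfloor>\<beta>\<rfloor> + 1)} \<subseteq> {t::nat. \<alpha> \<le> real t \<and> real t \<le> \<beta>}"
    using assms by auto linarith+
  then have "card {nat \<lceil>\<alpha>\<rceil>..<nat (\<lfloor>\<beta>\<rfloor> + 1)} \<le> card {t::nat. \<alpha> \<le> real t \<and> real t \<le> \<beta>}"
    by (rule card_mono[OF fin])
  moreover have "real (card {nat \<lceil>\<alpha>\<rceil>..<nat (\<lfloor>\<beta>\<rfloor> + 1)}) \<ge> \<beta> - \<alpha> - 1"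
    using assms by simp linarith
  ultimately show ?thesis by linarith
qed

text \<open>Frequencies \<open>k\<^sub>0 n\<^sup>2\<close> with \<open>n \<equiv> 1\<close> modulo \<open>K!\<close> are represented only once: in lowest terms
  \<open>n / j = r / s\<close>, the number \<open>r\<^sup>2\<close> divides \<open>k \<le> K\<close>, while \<open>r\<close> is coprime to \<open>K!\<close>.\<close>

lemma unique_representation:
  fixes n j k k0 K :: nat
  assumes eq: "k * j^2 = k0 * n^2" and k: "0 < k" "k \<le> K" and k0: "k0 > 0" and n: "n = 1 + fact K * t"
    and "j \<ge> 1"
  shows "k \<le> k0 \<and> (k = k0 \<longrightarrow> j = n)"
proof -
  define d where "d = gcd n j"
  obtain r s where n': "n = d * r" and j': "j = d * s"
    unfolding d_def by (meson dvdE gcd_dvd1 gcd_dvd2)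
  have d: "d > 0" using assms by (simp add: d_def)
  have "n = r * gcd n j" "j = s * gcd n j"
    by (metis n' d_def mult.commute, metis j' d_def mult.commute)
  then have "coprime r s"
    using d unfolding d_def by (intro gcd_coprime[of n j]) auto
  have "d^2 * (k * s^2) = d^2 * (k0 * r^2)"
    using eq by (simp add: n' j' power_mult_distrib ac_simps)
  then have eq': "k * s^2 = k0 * r^2" using d by simp
  then have "r^2 dvd k * s^2" by simp
  moreover have "coprime (r^2) (s^2)" using \<open>coprime r s\<close> by simp
  ultimately have "r^2 dvd k" by (simp add: coprime_dvd_mult_left_iff)
  then have "r dvd k" by (metis dvd_mult_left power2_eq_square)
  moreover have "k dvd fact K" using k by (intro dvd_fact) auto
  ultimately have "r dvd fact K * t" by (meson dvd_mult2 dvd_trans)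
  moreover have "r dvd 1 + fact K * t" using n n' by (metis dvd_triv_right)
  ultimately have "r dvd 1" by (metis dvd_add_left_iff)
  then have "r = 1" by simp
  with eq' have ks: "k * s^2 = k0" by simp
  then have "s > 0" using k0 by (intro gr0I) auto
  then have "k * 1 \<le> k * s^2" by (intro mult_left_mono) auto
  moreover have "j = n" if "k = k0"
  proof -
    have "s^2 = 1" using ks that k0 by simp
    then show ?thesis using \<open>r = 1\<close> by (simp add: n' j')
  qed
  ultimately show ?thesis using ks by simp
qed

section \<open>The test sum and its pairing with the increment\<close>

context trig_series
begin

lemma ex_min_freq:
  assumes "\<not> g constant_on UNIV"
  obtains k0 :: nat where "k0 \<ge> 1" "k0 \<le> K" "C (int k0) \<noteq> 0" "\<And>k. 1 \<le> k \<Longrightarrow> k < k0 \<Longrightarrow> C (int k) = 0"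
proof -
  have "\<exists>k\<in>freqs. C k \<noteq> 0"
  proof (rule ccontr)
    assume "\<not> ?thesis"
    then have "complex_of_real (g x) = 0" for x by (simp add: g_eq)
    then have "g constant_on UNIV" unfolding constant_on_def by simp
    with assms show False ..
  qed
  then obtain k where k: "k \<in> freqs" "C k \<noteq> 0" by blast
  have cnj: "C (- k) = cnj (C k)" for k using trig by (simp add: real_trig_poly_def)
  define P where "P m \<longleftrightarrow> m \<ge> 1 \<and> C (int m) \<noteq> 0" for m :: nat
  \<comment> \<open>The symmetry \<open>C (- k) = cnj (C k)\<close> moves a negative frequency to
    the positive side.\<close>
  have ab: "C \<bar>k\<bar> \<noteq> 0"
    using k cnj[of k] by (cases "k \<ge> 0") auto
  have "P (nat \<bar>k\<bar>)" using k ab freqs(2) by (cases "k = 0") (auto simp: P_def Suc_le_eq)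
  then have P: "P (LEAST m. P m)" and le: "(LEAST m. P m) \<le> nat \<bar>k\<bar>"
    by (auto intro: LeastI Least_le)
  have "nat \<bar>k\<bar> \<le> K" using k by (auto simp: freqs_def)
  show ?thesis
  proof (rule that[of "LEAST m. P m"])
    show "C (int i) = 0" if "1 \<le> i" "i < (LEAST m. P m)" for i
      using not_less_Least[OF that(2)] that(1) by (auto simp: P_def)
  qed (use P le \<open>nat \<bar>k\<bar> \<le> K\<close> in \<open>auto simp: P_def\<close>)
qed

text \<open>By orthogonality only solutions of \<open>k * j^2 = k0 * n^2\<close> contribute. They
  have \<open>k > 0\<close>, and \<open>unique_representation\<close> leaves \<open>k < k0\<close>,
  where the coefficient vanishes, or \<open>k = k0\<close> and \<open>j = n\<close>.\<close>

lemma pairing_integral: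
  assumes k0: "k0 \<ge> 1" "k0 \<le> K" "\<And>k. 1 \<le> k \<Longrightarrow> k < k0 \<Longrightarrow> C (int k) = 0"
    and B: "B \<subseteq> {1..T}" "\<And>n. n \<in> B \<Longrightarrow> \<exists>t. n = 1 + fact K * t"
  shows "((\<lambda>x. trig_sum (diff_coef h) freqs {1..T} x * cnj (trig_sum (\<lambda>_ _. 1) {int k0} B x)) has_integral
     (\<Sum>n\<in>B. diff_coef h (int k0) n)) {0..1}"
proof -
  have finB: "finite B" using B(1) finite_subset by blast
  have kf: "int k0 \<in> freqs" using k0 by (auto simp: freqs_def)
  have rep: "k = int k0 \<and> j = n" if *: "k * int j^2 = int k0 * int n^2" "k \<in> freqs" "j \<in> {1..T}" "n \<in> B" "C k \<noteq> 0" for k j n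
  proof -
    obtain t where t: "n = 1 + fact K * t" using B(2) * by blast
    have "n > 0" using t by simp
    then have "int k0 * int n^2 > 0" using k0 by simp
    then have "k > 0" using *(1) by (metis zero_less_mult_pos2 zero_less_power2 not_less_iff_gr_or_eq zero_less_mult_iff zero_le_power2 not_less)
    define m where "m = nat k"
    have m: "k = int m" "m > 0" "m \<le> K" using \<open>k > 0\<close> *(2) by (auto simp: m_def freqs_def)
    have "int (m * j^2) = int (k0 * n^2)" using *(1) m by simp
    then have "m * j^2 = k0 * n^2" by (simp only: of_nat_eq_iff)
    from unique_representation[OF this m(2,3) _ t] have "m \<le> k0" "m = k0 \<longrightarrow> j = n"
      using k0 *(3) by auto
    moreover have "\<not> m < k0" using k0(3)[of m] m *(5) by auto
    ultimately show ?thesis using m by auto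
  qed
  have "(\<Sum>k\<in>freqs. \<Sum>j\<in>{1..T}. \<Sum>n\<in>B. diff_coef h k j * (if k * int j^2 = int k0 * int n^2 then 1 else 0))
      = (\<Sum>k\<in>freqs. \<Sum>j\<in>{1..T}. \<Sum>n\<in>B. if k = int k0 then (if j = n then diff_coef h (int k0) n else 0) else 0)"
  proof (intro sum.cong refl)
    fix k j n assume *: "k \<in> freqs" "j \<in> {1..T}" "n \<in> B"
    show "diff_coef h k j * (if k * int j^2 = int k0 * int n^2 then 1 else 0)
      = (if k = int k0 then (if j = n then diff_coef h (int k0) n else 0) else 0)"
    proof (cases "C k = 0")
      case True
      then show ?thesis by (auto simp: coef_def)
    next
      case False
      then show ?thesis using rep[OF _ *] by (auto split: if_splits)
    qed
  qed
  also have "\<dots> = (\<Sum>k\<in>freqs. if k = int k0 then (\<Sum>j\<in>{1..T}. \<Sum>n\<in>B. if j = n then diff_coef h (int k0) n else 0) else 0)"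
    by (intro sum.cong refl) auto
  also have "\<dots> = (\<Sum>j\<in>{1..T}. \<Sum>n\<in>B. if j = n then diff_coef h (int k0) n else 0)"
    using freqs(1) kf by simp
  also have "\<dots> = (\<Sum>n\<in>B. \<Sum>j\<in>{1..T}. if j = n then diff_coef h (int k0) n else 0)"
    by (rule sum.swap)
  also have "\<dots> = (\<Sum>n\<in>B. diff_coef h (int k0) n)"
    using B(1) by (intro sum.cong refl) auto
  finally show ?thesis
    using has_integral_trig_sum_pairing[OF freqs(1) finite_atLeastAtMost finB, of "diff_coef h" 1 T "int k0"]
    by simp
qed

lemma one_minus_Re_echar_ge:
  assumes "1 / 4 \<le> x" "x \<le> 3 / 4"
  shows "1 \<le> 1 - Re (echar x)"
proof -
  have "cos (2 * (pi * x) - pi) \<ge> 0"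
  proof (rule cos_ge_zero)
    have "pi * (1 / 4) \<le> pi * x" "pi * x \<le> pi * (3 / 4)"
      using assms by (intro mult_left_mono; simp)+
    then show "- (pi / 2) \<le> 2 * (pi * x) - pi" "2 * (pi * x) - pi \<le> pi / 2" by linarith+
  qed
  then show ?thesis by (simp add: echar_def mult.assoc)
qed

text \<open>The condition on \<open>n\<close> puts the phase in the half circle where the cosine is
  at most 0. Each \<open>1 - echar\<close> then has real part at least 1, so taking real parts
  excludes cancellation between different \<open>n\<close>.\<close>

lemma norm_diff_coef_sum_ge:
  assumes B: "B \<subseteq> {1..N}" "N \<ge> 1" and x: "\<And>n. n \<in> B \<Longrightarrow> real k0 * (real n)^2 * h \<in> {1 / 4..3 / 4}"
  shows "norm (\<Sum>n\<in>B. diff_coef h (int k0) n) \<ge> norm (C (int k0)) * (real (card B) * real N powr (- 1 - \<delta>))"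
proof -
  define w where "w n = of_real (real n powr (- 1 - \<delta>)) * (1 - echar (real k0 * (real n)^2 * h))" for n
  have "(\<Sum>n\<in>B. diff_coef h (int k0) n) = - C (int k0) * (\<Sum>n\<in>B. w n)"
    by (simp add: coef_def w_def sum_distrib_left algebra_simps flip: sum_negf)
  then have "norm (\<Sum>n\<in>B. diff_coef h (int k0) n) = norm (C (int k0)) * norm (\<Sum>n\<in>B. w n)"
    by (simp add: norm_mult)
  moreover have "real (card B) * real N powr (- 1 - \<delta>) \<le> norm (\<Sum>n\<in>B. w n)"
  proof -
    have "real (card B) * real N powr (- 1 - \<delta>) = (\<Sum>n\<in>B. real N powr (- 1 - \<delta>) * 1)" by simp
    also have "\<dots> \<le> (\<Sum>n\<in>B. real n powr (- 1 - \<delta>) * (1 - Re (echar (real k0 * (real n)^2 * h))))"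
      using B x delta by (intro sum_mono mult_mono powr_mono2' one_minus_Re_echar_ge) auto
    also have "\<dots> = Re (\<Sum>n\<in>B. w n)" by (simp add: w_def)
    also have "\<dots> \<le> norm (\<Sum>n\<in>B. w n)" by (rule complex_Re_le_cmod)
    finally show ?thesis .
  qed
  ultimately show ?thesis by (simp add: mult_left_mono)
qed

text \<open>At \<open>u = sqrt (X / k0)\<close> the phase \<open>k0 * n^2 / X\<close> equals 1, so
  \<open>u / 2 \<le> n \<le> 4 / 5 * u\<close> keeps it between \<open>1 / 4\<close> and
  \<open>16 / 25\<close>. This range of length \<open>3 / 10 * u\<close> holds at least
  \<open>u / (5 * q)\<close> terms of the progression modulo \<open>q = fact K\<close> once
  \<open>u \<ge> 10 * q\<close>; the 100 in the hypothesis is the square of this 10.\<close>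

lemma many_good_indices:
  assumes k0: "k0 \<ge> 1" and X: "real X \<ge> 100 * (fact K)^2 * real k0" and M: "M \<ge> 1" "M^2 \<le> X" "X \<le> 4 * M^2"
  obtains B where "B \<subseteq> {1..2 * M}" "\<And>n. n \<in> B \<Longrightarrow> \<exists>t. n = 1 + fact K * t"
    "\<And>n. n \<in> B \<Longrightarrow> real k0 * (real n)^2 * (1 / real X) \<in> {1 / 4..3 / 4}"
    "real (card B) \<ge> real M / (5 * fact K * sqrt (real k0))"
proof -
  define u where "u = sqrt (real X / real k0)"
  define q :: real where "q = fact K"
  have q: "q \<ge> 1" unfolding q_def by (metis fact_ge_1)
  have X0: "real X > 0" using M by (metis less_le_trans of_nat_0_less_iff zero_less_power zero_less_one less_eq_Suc_le One_nat_def Suc_le_lessD)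
  have u2: "u^2 = real X / real k0" using X0 k0 by (simp add: u_def)
  have u: "u \<ge> 10 * q"
    unfolding u_def using X k0 by (intro real_le_rsqrt) (simp add: q_def field_simps power_mult_distrib)
  define T where "T = {t::nat. (u / 2 - 1) / q \<le> real t \<and> real t \<le> (4 / 5 * u - 1) / q}"
  define B where "B = (\<lambda>t. 1 + fact K * t) ` T"
  have bounds: "u / 2 \<le> real n \<and> real n \<le> 4 / 5 * u" if "n \<in> B" for n
  proof -
    obtain t where t: "n = 1 + fact K * t" "t \<in> T" using \<open>n \<in> B\<close> unfolding B_def by blast
    have "real n = 1 + q * real t" by (simp add: t q_def)
    moreover have "u / 2 - 1 \<le> q * real t" "q * real t \<le> 4 / 5 * u - 1"
      using t(2) q by (auto simp: T_def field_simps)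
    ultimately show ?thesis by linarith
  qed
  have Mu: "real M \<le> u * sqrt (real k0)"
  proof -
    have "real (M^2) \<le> real X" using M by (simp only: of_nat_le_iff)
    then have "real M \<le> sqrt (real X)" by (intro real_le_rsqrt) simp
    also have "\<dots> = u * sqrt (real k0)" using k0 by (simp add: u_def real_sqrt_divide)
    finally show ?thesis .
  qed
  have uM: "u \<le> 2 * real M"
  proof -
    have "real X \<le> real (4 * M^2)" using M by (simp only: of_nat_le_iff)
    moreover have "real X / real k0 \<le> real X / 1" using k0 by (intro divide_left_mono) auto
    ultimately have "u \<le> sqrt ((2 * real M)^2)"
      unfolding u_def by (intro real_sqrt_le_mono) (simp add: power_mult_distrib)
    then show ?thesis by (simp only: real_sqrt_abs)
  qed
  show ?thesis
  proof (rule that[of B])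
    show "B \<subseteq> {1..2 * M}"
    proof
      fix n assume n: "n \<in> B"
      then have "real n \<le> 2 * real M" using bounds[OF n] uM u q by linarith
      moreover have "n \<ge> 1" using n by (auto simp: B_def)
      ultimately show "n \<in> {1..2 * M}" by simp
    qed
    show "\<exists>t. n = 1 + fact K * t" if "n \<in> B" for n using that by (auto simp: B_def)
    show "real k0 * (real n)^2 * (1 / real X) \<in> {1 / 4..3 / 4}" if "n \<in> B" for n
    proof -
      have b: "u / 2 \<le> real n" "real n \<le> 4 / 5 * u" using bounds[OF that] by auto
      have "(u / 2)^2 \<le> (real n)^2" using b u q by (intro power_mono) auto
      moreover have "(real n)^2 \<le> (4 / 5 * u)^2" using b by (intro power_mono) auto
      ultimately have "1 / 4 * u^2 \<le> (real n)^2" "(real n)^2 \<le> 16 / 25 * u^2"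
        by (simp_all add: power_mult_distrib power_divide)
      then show ?thesis using X0 k0 unfolding u2 by (simp add: field_simps)
    qed
    have "real (card T) \<ge> (4 / 5 * u - 1) / q - (u / 2 - 1) / q - 1"
      unfolding T_def using u q by (intro card_nat_between_ge) auto
    moreover have "(4 / 5 * u - 1) / q - (u / 2 - 1) / q - 1 = u / (5 * q) + (u / (10 * q) - 1)"
      using q by (simp add: field_simps)
    moreover have "u / (10 * q) \<ge> 1" using u q by (simp add: field_simps)
    ultimately have "real (card T) \<ge> u / (5 * q)" by linarith
    moreover have "card B = card T"
      unfolding B_def by (intro card_image) (auto simp: inj_on_def)
    moreover have "real M / (5 * q * sqrt (real k0)) \<le> u / (5 * q)"
      using Mu q k0 by (simp add: field_simps)
    ultimately show "real (card B) \<ge> real M / (5 * fact K * sqrt (real k0))"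
      by (simp add: q_def)
  qed
qed

end

section \<open>From the pairing to a lower bound for the mean increment and the box count\<close>

context trig_series
begin

text \<open>Hoelder over the \<open>J + 1\<close> pieces, each of which satisfies the bound of the
  block at \<open>M\<close>: higher blocks because theirs decreases in \<open>m\<close>, the low
  part because \<open>1 / X \<le> 1 / M^2\<close> turns \<open>M^6 * h^4\<close> into at most
  \<open>1 / M^2\<close>.\<close>

lemma increment_power4_bound:
  assumes M: "M \<ge> 1" "M^2 \<le> X" and J: "1 + ln (2 * (2^J * real M)) \<le> \<Lambda>"
  defines "a \<equiv> real M powr (- \<delta>)"
  shows "integral {0..1} (\<lambda>x. norm (trig_sum (diff_coef (1 / real X)) freqs {1..2^J * M} x)^4)
    \<le> real (Suc J)^4 * (L4const * \<Lambda> * a^4 / real M^2)"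
proof -
  define h where "h = 1 / real X"
  define A where "A i = (case i of 0 \<Rightarrow> {1..M} | Suc j \<Rightarrow> {2^j * M<..2 * (2^j * M)})" for i
  define u where "u i = trig_sum (diff_coef h) freqs (A i)" for i
  define E where "E = L4const * \<Lambda> * a^4 / real M^2"
  have "1 \<le> M^2" using M(1) by simp
  then have X: "X \<ge> 1" using M(2) by linarith
  have h0: "h \<ge> 0" by (simp add: h_def)
  have "1 * 1 \<le> 2^J * real M" using M by (intro mult_mono) auto
  then have "ln (2 * (2^J * real M)) \<ge> 0" by (intro ln_ge_zero) simp
  then have \<Lambda>0: "\<Lambda> \<ge> 0" using J by simp
  have D0: "L4const * \<Lambda> \<ge> 0" using \<Lambda>0 L4const_nonneg by (intro mult_nonneg_nonneg)
  have a0: "a \<ge> 0" by (simp add: a_def)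
  have cont: "continuous_on {0..1} (u i)" for i
    unfolding u_def by (rule continuous_on_trig_sum[OF continuous_on_id])
  have split: "trig_sum (diff_coef h) freqs {1..2^J * M} x = (\<Sum>i<Suc J. u i x)" for x
    unfolding trig_sum_dyadic sum.lessThan_Suc_shift by (simp add: u_def A_def)
  have piece: "integral {0..1} (\<lambda>x. norm (u i x)^4) \<le> E" if i: "i < Suc J" for i
  proof (cases i)
    case 0
    have "1 * real M \<le> 2^J * real M" by (intro mult_right_mono) auto
    then have "ln (2 * real M) \<le> ln (2 * (2^J * real M))" using M by (intro ln_mono) auto
    then have "integral {0..1} (\<lambda>x. norm (u i x)^4) \<le> L4const * \<Lambda> * a^4 * real M^6 * h^4"
      unfolding u_def A_def 0 a_def using low_power4_bounds(2)[OF M(1) _ h0, of \<Lambda>] J by simp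
    also have "\<dots> \<le> L4const * \<Lambda> * a^4 * real M^6 * (1 / real M^2)^4"
    proof (intro mult_left_mono power_mono)
      have "real (M^2) \<le> real X" using M by (simp only: of_nat_le_iff)
      then show "h \<le> 1 / real M^2" using M(1) X unfolding h_def by (intro divide_left_mono) auto
    qed (use D0 a0 h0 in auto)
    also have "\<dots> = E"
    proof -
      have "real M^6 * (1 / real M^2)^4 = 1 / real M^2"
        using M(1) by (simp add: power_divide field_simps flip: power_mult power_add)
      then show ?thesis by (simp only: E_def mult.assoc) simp
    qed
    finally show ?thesis .
  next
    case (Suc j)
    define m where "m = 2^j * M"
    have m: "m \<ge> 1" "M \<le> m" using M by (auto simp: m_def)
    have "(2::real)^(Suc j) \<le> 2^J" using i Suc by (intro power_increasing) auto
    then have "4 * real m \<le> 2 * (2^J * real M)" using M by (simp add: m_def)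
    then have "ln (4 * real m) \<le> ln (2 * (2^J * real M))" using m by (intro ln_mono) auto
    then have "1 + ln (4 * real m) \<le> \<Lambda>" using J by linarith
    from high_power4_bounds(3)[OF m(1) this, of h]
    have "integral {0..1} (\<lambda>x. norm (u i x)^4) \<le> L4const * \<Lambda> * (real m powr (- \<delta>))^4 / real m^2"
      by (simp add: u_def A_def Suc m_def)
    also have "\<dots> \<le> L4const * \<Lambda> * a^4 / real M^2"
      unfolding a_def using m M \<Lambda>0 L4const_nonneg delta
      by (intro frac_le mult_left_mono power_mono powr_mono2' mult_nonneg_nonneg) auto
    finally show ?thesis by (simp add: E_def)
  qed
  have "integral {0..1} (\<lambda>x. norm (trig_sum (diff_coef h) freqs {1..2^J * M} x)^4)
      \<le> integral {0..1} (\<lambda>x. real (card {..<Suc J})^3 * (\<Sum>i<Suc J. norm (u i x)^4))"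
    unfolding split
    by (intro integral_le integrable_continuous_real continuous_intros cont norm_sum_power4_le)
  also have "\<dots> = real (Suc J)^3 * (\<Sum>i<Suc J. integral {0..1} (\<lambda>x. norm (u i x)^4))"
    unfolding card_lessThan integral_mult_right
    by (subst integral_sum) (auto intro!: integrable_continuous_real continuous_intros cont)
  also have "\<dots> \<le> real (Suc J)^3 * (\<Sum>i<Suc J. E)"
    using piece by (intro mult_left_mono sum_mono) auto
  also have "\<dots> = real (Suc J)^4 * E" by (simp add: power4_eq_xxxx power3_eq_cube)
  finally show ?thesis by (simp add: h_def E_def)
qed

text \<open>On the left stands the size of the pairing. On the right, the part where
  \<open>P\<close> is at most \<open>\<tau>\<close> times its typical size \<open>sqrt M\<close> is
  controlled by the first moment \<open>I\<close>, the rest by the two fourth moments.\<close>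

lemma integral_increment_ge:
  assumes k0: "k0 \<ge> 1" "k0 \<le> K" "\<And>k. 1 \<le> k \<Longrightarrow> k < k0 \<Longrightarrow> C (int k) = 0"
    and X: "real X \<ge> 100 * (fact K)^2 * real k0"
    and M: "M \<ge> 1" "M^2 \<le> X" "X \<le> 4 * M^2" and J: "J \<ge> 1" "1 + ln (2 * (2^J * real M)) \<le> \<Lambda>"
    and \<tau>: "\<tau> > 0"
  defines "a \<equiv> real M powr (- \<delta>)" and "I \<equiv> integral {0..1} (\<lambda>x. norm (trig_sum (diff_coef (1 / real X)) freqs {1..2^J * M} x))"
  shows "norm (C (int k0)) / (20 * fact K * sqrt (real k0)) * a
    \<le> \<tau> * sqrt (real M) * I + a / \<tau>^2 * (real (Suc J)^4 * L4const * \<Lambda> + 68 * \<Lambda>)"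
proof -
  define h where "h = 1 / real X"
  define f where "f = trig_sum (diff_coef h) freqs {1..2^J * M}"
  obtain B where B: "B \<subseteq> {1..2 * M}" "\<And>n. n \<in> B \<Longrightarrow> \<exists>t. n = 1 + fact K * t"
    "\<And>n. n \<in> B \<Longrightarrow> real k0 * (real n)^2 * h \<in> {1 / 4..3 / 4}"
    "real (card B) \<ge> real M / (5 * fact K * sqrt (real k0))"
  proof (rule many_good_indices[OF k0(1) X M])
    fix B assume "B \<subseteq> {1..2 * M}" "\<And>n. n \<in> B \<Longrightarrow> \<exists>t. n = 1 + fact K * t"
      "\<And>n. n \<in> B \<Longrightarrow> real k0 * (real n)^2 * (1 / real X) \<in> {1 / 4..3 / 4}"
      "real (card B) \<ge> real M / (5 * fact K * sqrt (real k0))"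
    then show thesis unfolding h_def[symmetric] by (rule that)
  qed
  define P where "P = trig_sum (\<lambda>_ _. 1) {int k0} B"
  have contf: "continuous_on {0..1} f" and contP: "continuous_on {0..1} P"
    unfolding f_def P_def by (rule continuous_on_trig_sum[OF continuous_on_id])+
  have a0: "a > 0" using M by (simp add: a_def)
  have sM: "sqrt (real M) > 0" "sqrt (real M)^4 = real M^2"
    using M by (auto simp: power4_eq_xxxx power2_eq_square)
  have "(2::nat)^1 \<le> 2^J" using J by (intro power_increasing) auto
  then have "2 * M \<le> 2^J * M" by simp
  then have "{1..2 * M} \<subseteq> {1..2^J * M}" by auto
  with B(1) have BT: "B \<subseteq> {1..2^J * M}" by (rule subset_trans)
  have P4: "integral {0..1} (\<lambda>x. norm (P x)^4) \<le> 68 * \<Lambda> * real M^2"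
  proof -
    have "integral {0..1} (\<lambda>x. norm (P x)^4) \<le> real (card {int k0})^4 * 1^4 * real (card (square_quads (2 * M)))"
      unfolding P_def using k0(1) B(1) by (intro integral_norm_power4_trig_sum_le) auto
    also have "\<dots> \<le> 17 * real (2 * M)^2 * (1 + ln (2 * real (2 * M)))"
      using card_square_quads_le[of "2 * M"] M(1) by simp
    also have "\<dots> \<le> 17 * real (2 * M)^2 * \<Lambda>"
    proof (intro mult_left_mono)
      have "(2::real)^1 \<le> 2^J" using J by (intro power_increasing) auto
      then have "2 * real (2 * M) \<le> 2 * (2^J * real M)" using M by simp
      then have "ln (2 * real (2 * M)) \<le> ln (2 * (2^J * real M))" using M by (intro ln_mono) auto
      then show "1 + ln (2 * real (2 * M)) \<le> \<Lambda>" using J by linarith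
    qed auto
    finally show ?thesis by (simp add: power_mult_distrib ac_simps)
  qed
  have f4: "integral {0..1} (\<lambda>x. norm (f x)^4) \<le> real (Suc J)^4 * (L4const * \<Lambda> * a^4 / real M^2)"
    unfolding f_def h_def a_def by (rule increment_power4_bound[OF M(1,2) J(2)])
  have "norm (C (int k0)) * (real (card B) * real (2 * M) powr (- 1 - \<delta>))
      \<le> norm (\<Sum>n\<in>B. diff_coef h (int k0) n)"
    using norm_diff_coef_sum_ge[OF B(1) _ B(3)] M by simp
  also have "\<dots> = norm (integral {0..1} (\<lambda>x. f x * cnj (P x)))"
    unfolding f_def P_def using integral_unique[OF pairing_integral[OF k0 BT B(2), of h]] by simp
  also have "\<dots> \<le> integral {0..1} (\<lambda>x. \<tau> * sqrt (real M) * norm (f x)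
       + a / \<tau>^2 * (real M^2 / a^4 * norm (f x)^4 + 1 / real M^2 * norm (P x)^4))"
  proof (rule integral_norm_bound_integral)
    show "norm (f x * cnj (P x)) \<le> \<tau> * sqrt (real M) * norm (f x)
       + a / \<tau>^2 * (real M^2 / a^4 * norm (f x)^4 + 1 / real M^2 * norm (P x)^4)" for x
    proof -
      \<comment> \<open>Both factors are divided by their typical sizes, \<open>a / sqrt M\<close>
        for \<open>f\<close> and \<open>sqrt M\<close> for \<open>P\<close>; the product of these
        sizes is \<open>a\<close>, which is multiplied back next.\<close>
      have "(sqrt (real M) / a * norm (f x)) * (norm (P x) / sqrt (real M))
          \<le> \<tau> * (sqrt (real M) / a * norm (f x))
            + ((sqrt (real M) / a * norm (f x))^4 + (norm (P x) / sqrt (real M))^4) / \<tau>^2"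
        using a0 sM \<tau> by (intro mult_le_truncated) auto
      then have "a * ((sqrt (real M) / a * norm (f x)) * (norm (P x) / sqrt (real M)))
          \<le> a * (\<tau> * (sqrt (real M) / a * norm (f x))
            + ((sqrt (real M) / a * norm (f x))^4 + (norm (P x) / sqrt (real M))^4) / \<tau>^2)"
        using a0 by (intro mult_left_mono) auto
      also have "a * ((sqrt (real M) / a * norm (f x)) * (norm (P x) / sqrt (real M))) = norm (f x * cnj (P x))"
        using a0 sM by (simp add: norm_mult)
      also have "a * (\<tau> * (sqrt (real M) / a * norm (f x))
            + ((sqrt (real M) / a * norm (f x))^4 + (norm (P x) / sqrt (real M))^4) / \<tau>^2)
          = \<tau> * sqrt (real M) * norm (f x)
            + a / \<tau>^2 * (real M^2 / a^4 * norm (f x)^4 + 1 / real M^2 * norm (P x)^4)"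
        using a0 by (simp add: power_mult_distrib power_divide sM(2) distrib_left add_divide_distrib ac_simps)
      finally show ?thesis .
    qed
  qed (intro integrable_continuous_real continuous_intros contf contP)+
  also have "\<dots> = \<tau> * sqrt (real M) * integral {0..1} (\<lambda>x. norm (f x))
       + a / \<tau>^2 * (real M^2 / a^4 * integral {0..1} (\<lambda>x. norm (f x)^4) + 1 / real M^2 * integral {0..1} (\<lambda>x. norm (P x)^4))"
    by (simp only: integral_add integral_mult_right integrable_continuous_real continuous_on_add continuous_on_mult
        continuous_on_const continuous_on_norm contf contP continuous_on_power)
  also have "\<dots> \<le> \<tau> * sqrt (real M) * integral {0..1} (\<lambda>x. norm (f x))
       + a / \<tau>^2 * (real M^2 / a^4 * (real (Suc J)^4 * (L4const * \<Lambda> * a^4 / real M^2)) + 1 / real M^2 * (68 * \<Lambda> * real M^2))"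
    using a0 by (intro add_left_mono mult_left_mono add_mono f4 P4) auto
  also have "real M^2 / a^4 * (real (Suc J)^4 * (L4const * \<Lambda> * a^4 / real M^2)) = real (Suc J)^4 * L4const * \<Lambda>"
    using a0 M(1) by simp
  also have "1 / real M^2 * (68 * \<Lambda> * real M^2) = 68 * \<Lambda>"
    using M(1) by simp
  finally have main: "norm (C (int k0)) * (real (card B) * real (2 * M) powr (- 1 - \<delta>))
     \<le> \<tau> * sqrt (real M) * integral {0..1} (\<lambda>x. norm (f x)) + a / \<tau>^2 * (real (Suc J)^4 * L4const * \<Lambda> + 68 * \<Lambda>)" .
  \<comment> \<open>The 4 uses \<open>\<delta> \<le> 1\<close>; with the 5 in the bound for
    \<open>card B\<close> it gives the 20 in the conclusion.\<close>
  have "real (2 * M) powr (- 1 - \<delta>) \<ge> a / (4 * real M)"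
  proof -
    have "(2::real) powr (- 2) \<le> 2 powr (- 1 - \<delta>)" using delta by (intro powr_mono) auto
    moreover have "(2::real) powr (- 2) = 1 / 4" by (simp add: powr_minus_divide)
    ultimately have "1 / 4 * (a / real M) \<le> 2 powr (- 1 - \<delta>) * (a / real M)"
      using a0 by (intro mult_right_mono) auto
    also have "\<dots> = real (2 * M) powr (- 1 - \<delta>)"
      using M(1) by (simp add: powr_mult powr_split a_def)
    finally show ?thesis by simp
  qed
  then have "norm (C (int k0)) * (real M / (5 * fact K * sqrt (real k0)) * (a / (4 * real M)))
      \<le> norm (C (int k0)) * (real (card B) * real (2 * M) powr (- 1 - \<delta>))"
    using B(4) a0 by (intro mult_left_mono mult_mono) auto
  also have "norm (C (int k0)) * (real M / (5 * fact K * sqrt (real k0)) * (a / (4 * real M)))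
      = norm (C (int k0)) / (20 * fact K * sqrt (real k0)) * a"
    using M(1) by simp
  finally show ?thesis using main by (simp add: I_def f_def h_def)
qed

lemma box_count_lower_powr:
  assumes "\<not> g constant_on UNIV"
  shows "\<exists>c>0. \<exists>c' X0. \<forall>X\<ge>X0. real (box_count X (graph_G \<delta> g))
    \<ge> c * real X powr (7 / 4 - \<delta> / 2) / (1 + ln (real X))^3 - c' * real X"
proof -
  obtain k0 where k0: "k0 \<ge> 1" "k0 \<le> K" "C (int k0) \<noteq> 0" "\<And>k. 1 \<le> k \<Longrightarrow> k < k0 \<Longrightarrow> C (int k) = 0"
    using ex_min_freq[OF assms] by metis
  define c0 where "c0 = norm (C (int k0)) / (20 * fact K * sqrt (real k0))"
  have c0: "c0 > 0" using k0 by (simp add: c0_def)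
  define q where "q = 2 / \<delta> + 4"
  have q: "q \<ge> 1" using delta by (simp add: q_def add_increasing)
  define e where "e = (2 * q)^4 * L4const * q + 68 * q"
  have e: "e > 0" using q L4const_nonneg by (simp add: e_def add_nonneg_pos)
  define \<tau>0 where "\<tau>0 = sqrt (2 * e / c0)"
  have \<tau>0: "\<tau>0 > 0" "\<tau>0^2 = 2 * e / c0" using e c0 by (simp_all add: \<tau>0_def)
  \<comment> \<open>A factor \<open>c0 / (2 * \<tau>0)\<close> comes from the bound for
    \<open>I\<close>, divided by the 6 of \<open>integral_increment_le_box_count\<close>.\<close>
  define c where "c = c0 / (12 * \<tau>0)"
  define X0 where "X0 = nat \<lceil>100 * (fact K)^2 * real k0\<rceil> + 1"
  have c: "c > 0" using c0 \<tau>0 by (simp add: c_def)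
  have "real (box_count X (graph_G \<delta> g))
    \<ge> c * real X powr (7 / 4 - \<delta> / 2) / (1 + ln (real X))^3 - Cmax / (3 * \<delta>) * real X" if XX: "X \<ge> X0" for X
  proof -
    define L where "L = 1 + ln (real X)"
    have X: "X \<ge> 1" using XX by (simp add: X0_def)
    have L: "L \<ge> 1" using X by (simp add: L_def)
    have "real X \<ge> real X0" using XX by simp
    then have XK: "real X \<ge> 100 * (fact K)^2 * real k0"
      unfolding X0_def by linarith
    obtain M J where P: "M \<ge> 1" "M^2 \<le> X" "X \<le> 4 * M^2" "J \<ge> 1" "real X \<le> (2^J) powr \<delta>"
      "real J \<le> q * L" "1 + ln (2 * (2^J * real M)) \<le> q * L"
      unfolding q_def L_def by (rule dyadic_parameters[OF X])
    define a where "a = real M powr (- \<delta>)"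
    have a0: "a > 0" using P by (simp add: a_def)
    define I where "I = integral {0..1} (\<lambda>x. norm (trig_sum (diff_coef (1 / real X)) freqs {1..2^J * M} x))"
    \<comment> \<open>Chosen so that the fourth-moment term, at most
      \<open>a / \<tau>^2 * (e * L^6)\<close>, takes away exactly half of
      \<open>c0 * a\<close>.\<close>
    define \<tau> where "\<tau> = \<tau>0 * L^3"
    have \<tau>: "\<tau> > 0" using \<tau>0 L by (simp add: \<tau>_def)
    have main: "c0 * a \<le> \<tau> * sqrt (real M) * I + a / \<tau>^2 * (real (Suc J)^4 * L4const * (q * L) + 68 * (q * L))"
      unfolding c0_def a_def I_def by (rule integral_increment_ge[OF k0(1,2,4) XK P(1-4,7) \<tau>])
    have "real (Suc J)^4 * L4const * (q * L) + 68 * (q * L) \<le> e * L^6"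
    proof -
      have "1 * 1 \<le> q * L" using q L by (intro mult_mono) auto
      then have "real (Suc J) \<le> 2 * q * L" using P(6) by simp
      then have "real (Suc J)^4 \<le> (2 * q * L)^4" by (intro power_mono) auto
      then have "real (Suc J)^4 * L4const * (q * L) \<le> (2 * q * L)^4 * L4const * (q * L)"
        using q L L4const_nonneg by (intro mult_right_mono) auto
      also have "\<dots> = (2 * q)^4 * L4const * q * L^5"
        by (simp add: power_mult_distrib numeral_eq_Suc ac_simps)
      \<comment> \<open>Four logarithms come from \<open>J\<close> and one from the count of
        quadruples; the exponent is raised to 6 to match \<open>\<tau>^2\<close>.\<close>
      also have "\<dots> \<le> (2 * q)^4 * L4const * q * L^6"
        using q L L4const_nonneg by (intro mult_left_mono power_increasing mult_nonneg_nonneg) auto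
      finally have 1: "real (Suc J)^4 * L4const * (q * L) \<le> (2 * q)^4 * L4const * q * L^6" .
      have "L^1 \<le> L^6" using L by (intro power_increasing) auto
      then have "68 * (q * L) \<le> 68 * q * L^6" using q by simp
      with 1 show ?thesis by (simp add: e_def distrib_right)
    qed
    then have "a / \<tau>^2 * (real (Suc J)^4 * L4const * (q * L) + 68 * (q * L)) \<le> a / \<tau>^2 * (e * L^6)"
      using a0 by (intro mult_left_mono) auto
    also have "\<dots> = c0 * a / 2"
    proof -
      have "\<tau>^2 = 2 * e / c0 * L^6" by (simp add: \<tau>_def power_mult_distrib \<tau>0(2) flip: power_mult)
      then show ?thesis using e c0 L by simp
    qed
    finally have "c0 * a / 2 \<le> \<tau> * sqrt (real M) * I" using main by linarith
    then have "c0 / (2 * \<tau>) * (a / sqrt (real M)) \<le> I"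
      using \<tau> P(1) by (simp add: field_simps)
    moreover have "c0 / (2 * \<tau>) * real X powr (- (1 / 4 + \<delta> / 2)) \<le> c0 / (2 * \<tau>) * (a / sqrt (real M))"
      unfolding a_def using c0 \<tau> powr_scale(2)[OF P(1,2)] by (intro mult_left_mono) auto
    ultimately have I: "c0 / (2 * \<tau>) * real X powr (- (1 / 4 + \<delta> / 2)) \<le> I" by linarith
    define t where "t = Cmax / \<delta> / real X"
    define H where "H x = \<bar>G \<delta> g (x + 1 / real X) - G \<delta> g x\<bar>" for x
    have contH: "continuous_on {0..1} H"
      unfolding H_def by (intro continuous_intros continuous_on_compose2[OF continuous_G] continuous_on_subset[OF continuous_G]) auto
    have "I \<le> integral {0..1} (\<lambda>x. H x + 2 * t)"
      unfolding I_def
    proof (rule integral_le)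
      fix x :: real
      define T where "T = trig_sum coef freqs {1..2^J * M}"
      have t: "norm (of_real (G \<delta> g x) - T x) \<le> t" for x
        unfolding T_def t_def by (rule tail_le[OF P(1,5) X])
      have split: "trig_sum (diff_coef (1 / real X)) freqs {1..2^J * M} x
          = of_real (G \<delta> g (x + 1 / real X) - G \<delta> g x) + (of_real (G \<delta> g x) - T x)
            - (of_real (G \<delta> g (x + 1 / real X)) - T (x + 1 / real X))"
        unfolding T_def trig_sum_diff[symmetric] by simp
      show "norm (trig_sum (diff_coef (1 / real X)) freqs {1..2^J * M} x) \<le> H x + 2 * t"
        unfolding split
        using t[of x] t[of "x + 1 / real X"]
          norm_triangle_ineq4[of "of_real (G \<delta> g (x + 1 / real X) - G \<delta> g x) + (of_real (G \<delta> g x) - T x)"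
            "of_real (G \<delta> g (x + 1 / real X)) - T (x + 1 / real X)"]
          norm_triangle_ineq[of "of_real (G \<delta> g (x + 1 / real X) - G \<delta> g x)" "of_real (G \<delta> g x) - T x"]
        unfolding H_def norm_of_real by linarith
    qed (intro integrable_continuous_real continuous_intros contH continuous_on_trig_sum)+
    also have "\<dots> = integral {0..1} H + 2 * t"
      by (subst integral_add) (auto intro!: integrable_continuous_real contH)
    also have "integral {0..1} H \<le> 6 * real (box_count X (graph_G \<delta> g)) / real X^2"
      unfolding H_def graph_G_def by (rule integral_increment_le_box_count[OF X continuous_G G_periodic])
    finally have "c0 / (2 * \<tau>) * real X powr (- (1 / 4 + \<delta> / 2))
        \<le> 6 * real (box_count X (graph_G \<delta> g)) / real X^2 + 2 * t"
      using I by linarith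
    then have "real X^2 / 6 * (c0 / (2 * \<tau>) * real X powr (- (1 / 4 + \<delta> / 2)))
        \<le> real X^2 / 6 * (6 * real (box_count X (graph_G \<delta> g)) / real X^2 + 2 * t)"
      by (intro mult_left_mono) auto
    also have "\<dots> = real (box_count X (graph_G \<delta> g)) + Cmax / (3 * \<delta>) * real X"
      using X by (simp add: t_def field_simps power2_eq_square)
    also have "real X^2 / 6 * (c0 / (2 * \<tau>) * real X powr (- (1 / 4 + \<delta> / 2)))
        = c * (real X^2 * real X powr (- (1 / 4 + \<delta> / 2))) / L^3"
      by (simp add: c_def \<tau>_def ac_simps)
    also have "real X^2 * real X powr (- (1 / 4 + \<delta> / 2)) = real X powr (7 / 4 - \<delta> / 2)"
    proof -
      have "real X powr 2 * real X powr (- (1 / 4 + \<delta> / 2)) = real X powr (2 + - (1 / 4 + \<delta> / 2))"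
        by (simp only: powr_add)
      then show ?thesis using X by simp
    qed
    finally show ?thesis by (simp add: L_def)
  qed
  then show ?thesis using c by blast
qed

end

section \<open>The box dimension\<close>

lemma tendsto_powr_log_ratio:
  fixes k s m :: real
  shows "(\<lambda>n. (k + s * ln (real n) + m * ln (1 + ln (real n))) / ln (real n)) \<longlonglongrightarrow> s"
proof -
  have "(\<lambda>n. k * (1 / ln (real n)) + s + m * (ln (1 + ln (real n)) / ln (real n))) \<longlonglongrightarrow> k * 0 + s + m * 0"
    by (intro tendsto_intros; real_asymp)
  then have "(\<lambda>n. k * (1 / ln (real n)) + s + m * (ln (1 + ln (real n)) / ln (real n))) \<longlonglongrightarrow> s"
    by simp
  moreover have "\<forall>\<^sub>F n in sequentially. k * (1 / ln (real n)) + s + m * (ln (1 + ln (real n)) / ln (real n))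
      = (k + s * ln (real n) + m * ln (1 + ln (real n))) / ln (real n)"
    using eventually_ge_at_top[of 2]
  proof eventually_elim
    case (elim n)
    then have "ln (real n) > 0" by simp
    then show ?case by (simp add: field_simps)
  qed
  ultimately show ?thesis by (rule Lim_transform_eventually)
qed

lemma (in trig_series) log_box_count_tendsto:
  assumes "\<not> g constant_on UNIV"
  shows "(\<lambda>n. ln (real (box_count n (graph_G \<delta> g))) / ln (real n)) \<longlonglongrightarrow> 7 / 4 - \<delta> / 2"
proof -
  define s where "s = 7 / 4 - \<delta> / 2"
  define N where "N n = real (box_count n (graph_G \<delta> g))" for n
  obtain c1 where c1: "c1 > 0" "\<And>n. n \<ge> 1 \<Longrightarrow> N n \<le> c1 * real n powr s * (1 + ln (real n))^2"
    using box_count_upper_powr unfolding s_def N_def by blast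
  obtain c2 c' n0 where c2: "c2 > 0"
    "\<And>n. n \<ge> n0 \<Longrightarrow> N n \<ge> c2 * real n powr s / (1 + ln (real n))^3 - c' * real n"
    using box_count_lower_powr[OF assms] unfolding s_def N_def by blast
  \<comment> \<open>Since \<open>\<delta> \<le> 1\<close>, the exponent \<open>s\<close> is at least
    \<open>5 / 4\<close>, so the linear error of the lower bound, which stems from the tail of the
    series, is eventually absorbed.\<close>
  have "(\<lambda>n. c' * (real n * (1 + ln (real n))^3 / real n powr (5 / 4))) \<longlonglongrightarrow> c' * 0"
    by (intro tendsto_intros) real_asymp
  then have "\<forall>\<^sub>F n in sequentially. c' * (real n * (1 + ln (real n))^3 / real n powr (5 / 4)) < c2 / 2"
    using c2(1) by (intro order_tendstoD) auto
  then have low: "\<forall>\<^sub>F n in sequentially. N n \<ge> c2 / 2 * real n powr s / (1 + ln (real n))^3"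
    using eventually_ge_at_top[of 2] eventually_ge_at_top[of n0]
  proof eventually_elim
    case (elim n)
    have n: "real n > 1" using elim by simp
    have L: "1 + ln (real n) > 0" using n by (simp add: add_pos_pos)
    have "c' * (real n * (1 + ln (real n))^3) \<le> c2 / 2 * real n powr (5 / 4)"
      using elim(1) n by (simp add: field_simps)
    also have "\<dots> \<le> c2 / 2 * real n powr s"
      using n c2(1) delta by (intro mult_left_mono powr_mono) (auto simp: s_def)
    finally have *: "c' * real n \<le> c2 / 2 * real n powr s / (1 + ln (real n))^3"
      using L by (simp add: field_simps)
    define R where "R = real n powr s / (1 + ln (real n))^3"
    have "c' * real n \<le> c2 / 2 * R" "c2 * R - c' * real n \<le> N n"
      using * c2(2)[OF elim(3)] by (simp_all add: R_def)
    then have "c2 / 2 * R \<le> N n" by simp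
    then show ?case by (simp add: R_def)
  qed
  have lower: "\<forall>\<^sub>F n in sequentially. (ln (c2 / 2) + s * ln (real n) + (- 3) * ln (1 + ln (real n))) / ln (real n) \<le> ln (N n) / ln (real n)"
    using low eventually_ge_at_top[of 2]
  proof eventually_elim
    case (elim n)
    have n: "real n > 1" using elim by simp
    have L: "1 + ln (real n) > 0" using n by (simp add: add_pos_pos)
    have "ln (c2 / 2 * real n powr s / (1 + ln (real n))^3) = ln (c2 / 2) + s * ln (real n) + (- 3) * ln (1 + ln (real n))"
      using n L c2(1) by (simp add: ln_mult ln_div ln_powr ln_realpow)
    moreover have "ln (c2 / 2 * real n powr s / (1 + ln (real n))^3) \<le> ln (N n)"
      using elim(1) n L c2(1) by (intro ln_mono) auto
    ultimately show ?case using n by (intro divide_right_mono) auto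
  qed
  have upper: "\<forall>\<^sub>F n in sequentially. ln (N n) / ln (real n) \<le> (ln c1 + s * ln (real n) + 2 * ln (1 + ln (real n))) / ln (real n)"
    using low eventually_ge_at_top[of 2]
  proof eventually_elim
    case (elim n)
    have n: "real n > 1" using elim by simp
    have L: "1 + ln (real n) > 0" using n by (simp add: add_pos_pos)
    have "0 < c2 / 2 * real n powr s / (1 + ln (real n))^3" using n L c2(1) by simp
    then have "0 < N n" using elim(1) by linarith
    then have "ln (N n) \<le> ln (c1 * real n powr s * (1 + ln (real n))^2)"
      using c1(2)[of n] elim(2) by (intro ln_mono) auto
    also have "\<dots> = ln c1 + s * ln (real n) + 2 * ln (1 + ln (real n))"
      using n L c1(1) by (simp add: ln_mult ln_powr ln_realpow)
    finally show ?case using n by (intro divide_right_mono) auto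
  qed
  show ?thesis
    using tendsto_sandwich[OF lower upper tendsto_powr_log_ratio tendsto_powr_log_ratio]
    by (simp add: N_def s_def)
qed

lemma box_dim_graph_G:
  assumes "0 < \<delta>" "\<delta> \<le> 1" "real_trig_poly N C g" "C 0 = 0" "\<not> g constant_on UNIV"
  shows "has_box_dim (graph_G \<delta> g)" and "box_dim (graph_G \<delta> g) = 7 / 4 - \<delta> / 2"
proof -
  interpret trig_series \<delta> N C g by standard (use assms in auto)
  note lim = log_box_count_tendsto[OF assms(5)]
  show "has_box_dim (graph_G \<delta> g)"
    unfolding has_box_dim_def using lim by (rule convergentI)
  show "box_dim (graph_G \<delta> g) = 7 / 4 - \<delta> / 2"
    unfolding box_dim_def using lim by (rule limI)
qed

text \<open>That vanishing sums cannot lower the dimension is rendered as a comparison: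
  \<open>g\<close> has at least the vanishing square-class sums of \<open>g'\<close>, yet its graph
  has no smaller dimension. All parts rest on one formula valid for every admissible
  polynomial.\<close>

theorem theorem1p3:
  fixes \<delta> :: real and N :: nat and C :: "int \<Rightarrow> complex" and g :: "real \<Rightarrow> real"
  assumes "0 < \<delta>" and "\<delta> \<le> 1"
    and "real_trig_poly N C g" and "C 0 = 0" and "\<not> g constant_on UNIV"
  shows "(has_box_dim (graph_G \<delta> g) \<and> box_dim (graph_G \<delta> g) = 7 / 4 - \<delta> / 2) \<and>
    (\<forall>D. D \<subseteq> {d::nat. d \<ge> 1 \<and> squarefree d} \<longrightarrow>
       (\<forall>d\<in>D. square_class_sum \<delta> C d = 0) \<longrightarrow>
         has_box_dim (graph_G \<delta> g) \<and> box_dim (graph_G \<delta> g) = 7 / 4 - \<delta> / 2) \<and>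
    (\<forall>N' C' g'. real_trig_poly N' C' g' \<longrightarrow> C' 0 = 0 \<longrightarrow> \<not> g' constant_on UNIV \<longrightarrow>
       (\<forall>d::nat. d \<ge> 1 \<longrightarrow> squarefree d \<longrightarrow>
          square_class_sum \<delta> C' d = 0 \<longrightarrow> square_class_sum \<delta> C d = 0) \<longrightarrow>
         box_dim (graph_G \<delta> g') \<le> box_dim (graph_G \<delta> g))"
proof -
  have "has_box_dim (graph_G \<delta> g)" "box_dim (graph_G \<delta> g) = 7 / 4 - \<delta> / 2"
    by (rule box_dim_graph_G[OF assms])+
  moreover have "box_dim (graph_G \<delta> g') = 7 / 4 - \<delta> / 2"
    if "real_trig_poly N' C' g'" "C' 0 = 0" "\<not> g' constant_on UNIV" for N' C' g'
    by (rule box_dim_graph_G(2)[OF assms(1,2) that])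
  ultimately show ?thesis by auto
qed

end
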